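(* Let $P$ be a connected finite poset. Assume that $P$ has at least two minimal elements and at least two maximal elements. Then $R[\mathcal{I}(P)]$ does not satisfy property $N_3$.
   Context: $K$ is a field and all posets are finite. For a poset $P=\{p_1,\ldots,p_n\}$, $\mathcal{I}(P)$ is the distributive lattice of order ideals (down-closed subsets, including $\emptyset$ and $P$) of $P$, ordered by inclusion. The Hibi ring $R[\mathcal{I}(P)]$ is the $K$-subalgebra of the polynomial ring $K[t,z_1,\ldots,z_n]$ generated by the monomials $u_\alpha=t\prod_{p_i\in\alpha}z_i$, $\alpha\in\mathcal{I}(P)$; it is standard graded via $\deg t=1$, $\deg z_i=0$. It is a quotient of the polynomial ring $K[\mathcal{I}(P)]=K[x_\alpha:\alpha\in\mathcal{I}(P)]$ via $x_\alpha\mapsto u_\alpha$, and $\beta_{ij}(R[\mathcal{I}(P)])$ denotes its graded Betti numbers (homological degree $i$, internal degree $j$) over $K[\mathcal{I}(P)]$. For $p\in\mathbb{N}$, the ring satisfies (Green–Lazarsfeld) property $N_p$ if it is normal and $\beta_{ij}=0$ for all $1\le i\le p$ and $j\ne i+1$. A poset is connected if it is not the disjoint union of two nonempty posets (with no relations between them). *)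

theory Defs
  imports Complex_Main "HOL-Library.Poly_Mapping"
begin

section \<open>Posets and order ideals\<close>

text \<open>A (nonempty) finite poset is a type \<open>'p\<close> of class \<open>finite\<close> and \<open>order\<close>.\<close>

definition minimal_elements :: "'p::order set" where
  "minimal_elements = {p. \<not> (\<exists>q. q < p)}"

definition maximal_elements :: "'p::order set" where
  "maximal_elements = {p. \<not> (\<exists>q. p < q)}"

definition connected_poset :: "'p::order itself \<Rightarrow> bool" where
  "connected_poset _ \<longleftrightarrow>
     \<not> (\<exists>A B :: 'p set. A \<noteq> {} \<and> B \<noteq> {} \<and> A \<inter> B = {} \<and> A \<union> B = UNIV \<and>
           (\<forall>a\<in>A. \<forall>b\<in>B. \<not> a \<le> b \<and> \<not> b \<le> a))"

typedef (overloaded) 'p order_ideal = "{I :: 'p::order set. \<forall>x\<in>I. \<forall>y. y \<le> x \<longrightarrow> y \<in> I}"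
  morphisms elements Order_Ideal
  by (rule exI[of _ "{}"]) simp


section \<open>Polynomial rings\<close>

text \<open>
  Polynomials over \<open>'k\<close> in the variables \<open>'v\<close> are the finitely supported functions from
  monomials (exponent vectors \<open>'v \<Rightarrow>\<^sub>0 nat\<close>) to coefficients, with the convolution product
  of \<^theory>\<open>HOL-Library.Poly_Mapping\<close>.
\<close>

type_synonym ('v, 'k) mpoly = "('v \<Rightarrow>\<^sub>0 nat) \<Rightarrow>\<^sub>0 'k"

definition mp_const :: "'k::zero \<Rightarrow> ('v, 'k) mpoly" where
  "mp_const c = Poly_Mapping.single 0 c"

definition mp_var :: "'v \<Rightarrow> ('v, 'k::zero_neq_one) mpoly" where
  "mp_var v = Poly_Mapping.single (Poly_Mapping.single v 1) 1"

definition monomial_degree :: "('v \<Rightarrow>\<^sub>0 nat) \<Rightarrow> nat" where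
  "monomial_degree m = (\<Sum>v\<in>Poly_Mapping.keys m. Poly_Mapping.lookup m v)"

definition mp_subst ::
  "('v \<Rightarrow> ('w, 'k) mpoly) \<Rightarrow> ('v, 'k) mpoly \<Rightarrow> ('w, 'k::comm_ring_1) mpoly" where
  "mp_subst u f = (\<Sum>m\<in>Poly_Mapping.keys f. mp_const (Poly_Mapping.lookup f m) *
                     (\<Prod>v\<in>Poly_Mapping.keys m. u v ^ Poly_Mapping.lookup m v))"

inductive_set subalgebra_generated ::
  "('v, 'k::comm_ring_1) mpoly set \<Rightarrow> ('v, 'k) mpoly set"
  for G :: "('v, 'k) mpoly set" where
  const: "mp_const c \<in> subalgebra_generated G"
| gen: "g \<in> G \<Longrightarrow> g \<in> subalgebra_generated G"
| add: "f \<in> subalgebra_generated G \<Longrightarrow> g \<in> subalgebra_generated G \<Longrightarrow>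
        f + g \<in> subalgebra_generated G"
| mult: "f \<in> subalgebra_generated G \<Longrightarrow> g \<in> subalgebra_generated G \<Longrightarrow>
         f * g \<in> subalgebra_generated G"


section \<open>Normality\<close>

text \<open>
  For a subring \<open>R\<close> of a commutative ring: \<open>R\<close> is a domain and is integrally closed in its
  field of fractions. An integral equation for \<open>x = a / b\<close>,
  \<open>x ^ n + c (n - 1) * x ^ (n - 1) + \<dots> + c 0 = 0\<close>, is multiplied by \<open>b ^ n\<close>, and
  \<open>a / b \<in> R\<close> is written as \<open>b\<close> dividing \<open>a\<close> in \<open>R\<close>.
\<close>

definition normal_domain :: "'a::comm_ring_1 set \<Rightarrow> bool" where
  "normal_domain R \<longleftrightarrow>
     (\<forall>a\<in>R. \<forall>b\<in>R. a * b = 0 \<longrightarrow> a = 0 \<or> b = 0) \<and>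
     (\<forall>a\<in>R. \<forall>b\<in>R. b \<noteq> 0 \<and>
        (\<exists>n c. (\<forall>i<n. c i \<in> R) \<and> a ^ n + (\<Sum>i<n. c i * a ^ i * b ^ (n - i)) = 0) \<longrightarrow>
        (\<exists>r\<in>R. a = b * r))"


section \<open>Minimal graded free resolutions and graded Betti numbers\<close>

text \<open>
  The free module on a set \<open>B\<close> of basis indices; vectors are finitely supported.
\<close>

definition free_module :: "'b set \<Rightarrow> ('b \<Rightarrow>\<^sub>0 'r::zero) set" where
  "free_module B = {x. Poly_Mapping.keys x \<subseteq> B}"

definition free_scale :: "'r::comm_ring_1 \<Rightarrow> ('b \<Rightarrow>\<^sub>0 'r) \<Rightarrow> ('b \<Rightarrow>\<^sub>0 'r)" where
  "free_scale s x = Poly_Mapping.map ((*) s) x"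

text \<open>The linear map sending the \<open>k\<close>-th basis vector to \<open>g k\<close>.\<close>

definition linear_extension ::
  "('r::comm_ring_1 \<Rightarrow> 'm \<Rightarrow> 'm) \<Rightarrow> ('b \<Rightarrow> 'm) \<Rightarrow> ('b \<Rightarrow>\<^sub>0 'r) \<Rightarrow> 'm::ab_group_add" where
  "linear_extension scale g x =
     (\<Sum>k\<in>Poly_Mapping.keys x. scale (Poly_Mapping.lookup x k) (g k))"

text \<open>
  Here \<open>S = ('v, 'k) mpoly\<close> carries the standard grading, and \<open>M\<close> is an \<open>S\<close>-module (via
  \<open>scale\<close>) whose homogeneous component of degree \<open>j\<close> is \<open>gr j\<close>. The resolution is
  \<open>\<dots> \<rightarrow> F 2 \<rightarrow> F 1 \<rightarrow> F 0 \<rightarrow> M \<rightarrow> 0\<close>, where \<open>F i\<close> has the basis \<open>B i\<close>, with \<open>k \<in> B i\<close> placed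
  in degree \<open>d i k\<close>; that is, \<open>F i\<close> is the direct sum of the modules \<open>S(- d i k)\<close>.
  The augmentation maps the basis vector \<open>k \<in> B 0\<close> to \<open>aug k\<close>, and \<open>F (i + 1) \<rightarrow> F i\<close> maps
  \<open>k \<in> B (i + 1)\<close> to \<open>diff i k\<close>. The maps are homogeneous of degree 0; minimality says
  that the image of \<open>F (i + 1)\<close> lies in \<open>\<mm> * F i\<close>, \<open>\<mm>\<close> being the irrelevant
  maximal ideal. The \<open>B i\<close> are only required to be finite in each degree; if \<open>M\<close> is
  finitely generated they are automatically finite.
\<close>

definition minimal_graded_free_resolution ::
  "(('v, 'k::field) mpoly \<Rightarrow> 'm \<Rightarrow> 'm) \<Rightarrow> 'm::ab_group_add set \<Rightarrow> (nat \<Rightarrow> 'm set) \<Rightarrow>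
   (nat \<Rightarrow> nat set) \<Rightarrow> (nat \<Rightarrow> nat \<Rightarrow> nat) \<Rightarrow>
   (nat \<Rightarrow> 'm) \<Rightarrow> (nat \<Rightarrow> nat \<Rightarrow> (nat \<Rightarrow>\<^sub>0 ('v, 'k) mpoly)) \<Rightarrow> bool" where
  "minimal_graded_free_resolution scale M gr B d aug diff \<longleftrightarrow>
     \<comment> \<open>graded free modules and homogeneous maps\<close>
     (\<forall>i j. finite {k \<in> B i. d i k = j}) \<and>
     (\<forall>k\<in>B 0. aug k \<in> gr (d 0 k)) \<and>
     (\<forall>i. \<forall>k\<in>B (Suc i). diff i k \<in> free_module (B i) \<and>
        (\<forall>l\<in>B i. \<forall>m\<in>Poly_Mapping.keys (Poly_Mapping.lookup (diff i k) l).
           monomial_degree m + d i l = d (Suc i) k)) \<and>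
     \<comment> \<open>exactness\<close>
     linear_extension scale aug ` free_module (B 0) = M \<and>
     linear_extension free_scale (diff 0) ` free_module (B 1) =
       {x \<in> free_module (B 0). linear_extension scale aug x = 0} \<and>
     (\<forall>i. linear_extension free_scale (diff (Suc i)) ` free_module (B (Suc (Suc i))) =
       {x \<in> free_module (B (Suc i)). linear_extension free_scale (diff i) x = 0}) \<and>
     \<comment> \<open>minimality: no entry of a differential has a nonzero constant term\<close>
     (\<forall>i. \<forall>k\<in>B (Suc i). \<forall>l\<in>B i.
        Poly_Mapping.lookup (Poly_Mapping.lookup (diff i k) l) 0 = 0)"

text \<open>
  The graded Betti number is the number of basis elements of degree \<open>j\<close> in homological degree
  \<open>i\<close> of the minimal graded free resolution. The latter is unique up to isomorphism, so
  the choice made by \<open>SOME\<close> is immaterial; one choice serves all \<open>i\<close> and \<open>j\<close>.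
\<close>

definition graded_betti ::
  "(('v, 'k::field) mpoly \<Rightarrow> 'm \<Rightarrow> 'm) \<Rightarrow> 'm::ab_group_add set \<Rightarrow> (nat \<Rightarrow> 'm set) \<Rightarrow>
   nat \<Rightarrow> nat \<Rightarrow> nat" where
  "graded_betti scale M gr i j =
     (let (B, d) = (SOME (B, d). \<exists>aug diff.
                      minimal_graded_free_resolution scale M gr B d aug diff)
      in card {k \<in> B i. d i k = j})"


section \<open>Hibi rings\<close>

datatype 'p hibi_var = T | Z 'p

definition hibi_gen :: "'p::{finite,order} order_ideal \<Rightarrow> ('p hibi_var, 'k::field) mpoly" where
  "hibi_gen \<alpha> = mp_var T * (\<Prod>p\<in>elements \<alpha>. mp_var (Z p))"

definition hibi_ring :: "('p::{finite,order} hibi_var, 'k::field) mpoly set" where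
  "hibi_ring = subalgebra_generated (range hibi_gen)"

definition hibi_component :: "nat \<Rightarrow> ('p::{finite,order} hibi_var, 'k::field) mpoly set" where
  "hibi_component j =
     {f \<in> hibi_ring. \<forall>m\<in>Poly_Mapping.keys f. Poly_Mapping.lookup m T = j}"

text \<open>
  The structure of module over \<open>K[x\<^sub>\<alpha> : \<alpha> an order ideal]\<close> given by
  \<open>x\<^sub>\<alpha> \<mapsto> hibi_gen \<alpha>\<close>.
\<close>

definition hibi_scale ::
  "('p::{finite,order} order_ideal, 'k::field) mpoly \<Rightarrow>
   ('p hibi_var, 'k) mpoly \<Rightarrow> ('p hibi_var, 'k) mpoly" where
  "hibi_scale f r = mp_subst hibi_gen f * r"

definition hibi_betti ::
  "'p::{finite,order} itself \<Rightarrow> 'k::field itself \<Rightarrow> nat \<Rightarrow> nat \<Rightarrow> nat" where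
  "hibi_betti _ _ =
     graded_betti (hibi_scale :: ('p order_ideal, 'k) mpoly \<Rightarrow> _) hibi_ring hibi_component"

text \<open>The Green--Lazarsfeld property \<open>N\<^sub>r\<close> of the Hibi ring over \<open>'k\<close> of the poset \<open>'p\<close>.\<close>

definition hibi_property_N ::
  "'p::{finite,order} itself \<Rightarrow> 'k::field itself \<Rightarrow> nat \<Rightarrow> bool" where
  "hibi_property_N P K r \<longleftrightarrow>
     normal_domain (hibi_ring :: ('p hibi_var, 'k) mpoly set) \<and>
     (\<forall>i j. 1 \<le> i \<and> i \<le> r \<and> j \<noteq> i + 1 \<longrightarrow> hibi_betti P K i j = 0)"

end

(*
  A connected poset with two minimal and two maximal elements contains elements a, b < c and b < d with
  a, b and c, d incomparable. If also a < d, consider the complements of the filters generated by a, b, c and d.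
  The relation between the first two and the one between the last two specialize to y0 y1 and y2 y3;
  their Koszul syzygy has degree 4, so already N_2 fails. Otherwise {a, b, c, d} becomes a lattice after adding a
  bottom and a top, and hence is a retract of the poset completed in the same way. Its Hibi ring is
  Gorenstein of codimension 3, resolved by the Pfaffians of a 5 x 5 matrix with a last syzygy of degree 5,
  and specializes to the edge ideal of a pentagon, so N_3 fails. In both cases, a linear strand of the given
  poset maps to the resolution of the specialized ideal; this map vanishes in the critical degree, although
  it would have to send the critical syzygy to a basis element.

  Betti numbers are defined by choosing a minimal graded free resolution, so that the existence of one is
  part of the proof.
*)

theory Submission
  imports Defs "HOL-Library.Nat_Bijection" "HOL-Computational_Algebra.Polynomial"
begin

section \<open>Finitely supported functions\<close>

text \<open>If every basis element of F i has degree i + 1 for 1 <= i <= 3, a homogeneous comparison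
  map to the linear strand of the edge ideal sends basis elements to scalar combinations of basis
  elements. Its coordinates can therefore be written down directly, as the functionals
  \<open>\<Phi> c\<close> whose scalars are read off from specialized entries. The critical syzygy
  is a combination of linear syzygies of the strand, all of which one coordinate kills; this forces
  a certain constant term to be 0. The same constant term is 1, since some quadric of the ideal
  specializes to a single edge. Both specializations send the variable of an order ideal to 0 if its
  trace on {a, b, c, d} is empty, {a, b} or everything, and to some y i otherwise. Each Hibi
  relation of the four-element subposet then loses exactly one of its two monomials, and the
  remaining monomials are the edges. The resolution at hand is the one picked by
  \<open>SOME\<close>, of which nothing but the defining properties is known; in particular, that F
  0 has rank 1 and is generated in degree 0 has to be derived.\<close>

lemma poly_mapping_sum_single: "f = (\<Sum>k\<in>Poly_Mapping.keys f. Poly_Mapping.single k (Poly_Mapping.lookup f k))"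
proof (rule poly_mapping_eqI)
  fix k
  have "(\<Sum>l\<in>Poly_Mapping.keys f. Poly_Mapping.lookup (Poly_Mapping.single l (Poly_Mapping.lookup f l)) k)
      = (\<Sum>l\<in>Poly_Mapping.keys f. if l = k then Poly_Mapping.lookup f l else 0)"
    by (intro sum.cong) (auto simp: lookup_single when_def)
  also have "\<dots> = Poly_Mapping.lookup f k"
    by (simp add: sum.delta in_keys_iff)
  finally show "Poly_Mapping.lookup f k = Poly_Mapping.lookup
      (\<Sum>k\<in>Poly_Mapping.keys f. Poly_Mapping.single k (Poly_Mapping.lookup f k)) k"
    by (simp add: lookup_sum)
qed

lemma poly_mapping_single_add_induct [case_names zero single add]:
  fixes f :: "'a \<Rightarrow>\<^sub>0 'b::comm_monoid_add"
  assumes "P 0" "\<And>k c. P (Poly_Mapping.single k c)" "\<And>f g. P f \<Longrightarrow> P g \<Longrightarrow> P (f + g)"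
  shows "P f"
proof -
  have "P (\<Sum>k\<in>A. Poly_Mapping.single k (c k))" if "finite A" for A and c :: "'a \<Rightarrow> 'b"
    using that by induction (use assms in auto)
  from this[OF finite_keys] show ?thesis
    by (subst poly_mapping_sum_single)
qed

lemma lookup_free_scale [simp]:
  "Poly_Mapping.lookup (free_scale s x) k = s * Poly_Mapping.lookup x k"
  unfolding free_scale_def by transfer (auto simp: when_def)

lemma module_free_scale: "module (free_scale :: 'r::comm_ring_1 \<Rightarrow> ('b \<Rightarrow>\<^sub>0 'r) \<Rightarrow> _)"
  by standard (rule poly_mapping_eqI; simp add: lookup_add algebra_simps)+

lemma free_module_add: "x \<in> free_module B \<Longrightarrow> y \<in> free_module B \<Longrightarrow> x + y \<in> free_module B"
  unfolding free_module_def using keys_add[of x y] by auto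

lemma free_module_iff: "x \<in> free_module B \<longleftrightarrow> (\<forall>k. k \<notin> B \<longrightarrow> Poly_Mapping.lookup x k = 0)"
  unfolding free_module_def by (auto simp: in_keys_iff)

lemma free_module_scale: "x \<in> free_module B \<Longrightarrow> free_scale s x \<in> free_module B"
  by (simp add: free_module_iff)

lemma free_module_zero: "0 \<in> free_module B"
  by (simp add: free_module_def)

lemma free_module_sum: "(\<And>k. k \<in> A \<Longrightarrow> f k \<in> free_module B) \<Longrightarrow> sum f A \<in> free_module B"
  by (induction A rule: infinite_finite_induct) (auto intro: free_module_add free_module_zero)

lemma free_module_single: "k \<in> B \<Longrightarrow> Poly_Mapping.single k s \<in> free_module B"
  by (simp add: free_module_def)

context module
begin

lemma linear_extension_superset:
  assumes "finite X" "Poly_Mapping.keys x \<subseteq> X"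
  shows "linear_extension scale g x = (\<Sum>k\<in>X. scale (Poly_Mapping.lookup x k) (g k))"
  unfolding linear_extension_def
  using assms by (intro sum.mono_neutral_left) (auto simp: in_keys_iff)

lemma linear_extension_zero [simp]: "linear_extension scale g 0 = 0"
  by (simp add: linear_extension_def)

lemma linear_extension_single [simp]:
  "linear_extension scale g (Poly_Mapping.single k s) = scale s (g k)"
  by (cases "s = 0") (auto simp: linear_extension_def)

lemma linear_extension_add:
  "linear_extension scale g (x + y) = linear_extension scale g x + linear_extension scale g y"
proof -
  let ?X = "Poly_Mapping.keys x \<union> Poly_Mapping.keys y"
  show ?thesis
    using keys_add[of x y]
    by (simp add: linear_extension_superset[of ?X] lookup_add scale_left_distrib sum.distrib)
qed

lemma linear_extension_scale:
  "linear_extension scale g (free_scale s x) = scale s (linear_extension scale g x)"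
proof -
  have "Poly_Mapping.keys (free_scale s x) \<subseteq> Poly_Mapping.keys x"
    by (auto simp: in_keys_iff)
  then show ?thesis
    by (simp add: linear_extension_superset[of "Poly_Mapping.keys x"] scale_sum_right)
qed

lemma linear_extension_minus:
  "linear_extension scale g (x - y) = linear_extension scale g x - linear_extension scale g y"
  using linear_extension_add[of g "x - y" y] by (simp add: algebra_simps)

lemma linear_extension_sum:
  "linear_extension scale g (sum f A) = (\<Sum>a\<in>A. linear_extension scale g (f a))"
  by (induction A rule: infinite_finite_induct) (simp_all add: linear_extension_add)

lemma linear_extension_comp:
  "linear_extension scale g (linear_extension free_scale h w) =
   linear_extension scale (\<lambda>k. linear_extension scale g (h k)) w"
  unfolding linear_extension_def[of free_scale] linear_extension_sum linear_extension_scale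
  by (simp add: linear_extension_def)

end

lemma linear_extension_free_in:
  "(\<And>k. k \<in> Poly_Mapping.keys x \<Longrightarrow> g k \<in> free_module B) \<Longrightarrow>
   linear_extension free_scale g x \<in> free_module B"
  unfolding linear_extension_def by (intro free_module_sum free_module_scale)

lemma lookup_linear_extension:
  "Poly_Mapping.lookup (linear_extension free_scale g x) l =
   linear_extension (*) (\<lambda>k. Poly_Mapping.lookup (g k) l) x"
  unfolding linear_extension_def by (simp add: lookup_sum)

section \<open>Evaluation of polynomials\<close>

definition eval_monomial :: "('v \<Rightarrow> 'a::comm_ring_1) \<Rightarrow> ('v \<Rightarrow>\<^sub>0 nat) \<Rightarrow> 'a" where
  "eval_monomial u m = (\<Prod>v\<in>Poly_Mapping.keys m. u v ^ Poly_Mapping.lookup m v)"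

definition eval_mpoly :: "('k::comm_ring_1 \<Rightarrow> 'a) \<Rightarrow> ('v \<Rightarrow> 'a::comm_ring_1) \<Rightarrow> ('v, 'k) mpoly \<Rightarrow> 'a" where
  "eval_mpoly \<iota> u f = (\<Sum>m\<in>Poly_Mapping.keys f. \<iota> (Poly_Mapping.lookup f m) * eval_monomial u m)"

lemma mp_subst_eq_eval: "mp_subst = eval_mpoly mp_const"
  by (intro ext) (simp add: mp_subst_def eval_mpoly_def eval_monomial_def)

lemma eval_monomial_superset:
  assumes "finite X" "Poly_Mapping.keys m \<subseteq> X"
  shows "eval_monomial u m = (\<Prod>v\<in>X. u v ^ Poly_Mapping.lookup m v)"
  unfolding eval_monomial_def
  using assms by (intro prod.mono_neutral_left) (auto simp: in_keys_iff)

lemma eval_monomial_0 [simp]: "eval_monomial u 0 = 1"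
  by (simp add: eval_monomial_def)

lemma eval_monomial_single [simp]: "eval_monomial u (Poly_Mapping.single v n) = u v ^ n"
  by (cases "n = 0") (auto simp: eval_monomial_def)

lemma eval_monomial_add: "eval_monomial u (m + n) = eval_monomial u m * eval_monomial u n"
proof -
  let ?X = "Poly_Mapping.keys m \<union> Poly_Mapping.keys n"
  show ?thesis
    using keys_add[of m n]
    by (simp add: eval_monomial_superset[of ?X] lookup_add power_add prod.distrib)
qed

text \<open>The coefficient map is kept general because it is instantiated twice: by
  \<open>mp_const\<close> for the presentation of the Hibi ring, and by constant polynomials for the
  specialization.\<close>

locale scalar_hom =
  fixes \<iota> :: "'k::comm_ring_1 \<Rightarrow> 'a::comm_ring_1"
  assumes hom_one [simp]: "\<iota> 1 = 1"
    and hom_add: "\<iota> (a + b) = \<iota> a + \<iota> b"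
    and hom_mult: "\<iota> (a * b) = \<iota> a * \<iota> b"
begin

lemma hom_zero [simp]: "\<iota> 0 = 0"
  using hom_add[of 0 0] by simp

lemma eval_superset:
  assumes "finite X" "Poly_Mapping.keys f \<subseteq> X"
  shows "eval_mpoly \<iota> u f = (\<Sum>m\<in>X. \<iota> (Poly_Mapping.lookup f m) * eval_monomial u m)"
  unfolding eval_mpoly_def
  using assms by (intro sum.mono_neutral_left) (auto simp: in_keys_iff)

lemma eval_zero [simp]: "eval_mpoly \<iota> u 0 = 0"
  by (simp add: eval_mpoly_def)

lemma eval_single: "eval_mpoly \<iota> u (Poly_Mapping.single m c) = \<iota> c * eval_monomial u m"
  by (cases "c = 0") (auto simp: eval_mpoly_def)

lemma eval_const [simp]: "eval_mpoly \<iota> u (mp_const c) = \<iota> c"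
  by (simp add: mp_const_def eval_single)

lemma eval_var [simp]: "eval_mpoly \<iota> u (mp_var v) = u v"
  by (simp add: mp_var_def eval_single)

lemma eval_add: "eval_mpoly \<iota> u (f + g) = eval_mpoly \<iota> u f + eval_mpoly \<iota> u g"
proof -
  let ?X = "Poly_Mapping.keys f \<union> Poly_Mapping.keys g"
  show ?thesis
    using keys_add[of f g]
    by (simp add: eval_superset[of ?X] lookup_add hom_add sum.distrib algebra_simps)
qed

lemma eval_mult: "eval_mpoly \<iota> u (f * g) = eval_mpoly \<iota> u f * eval_mpoly \<iota> u g"
proof (induction f rule: poly_mapping_single_add_induct)
  case (single m c)
  show ?case
    by (induction g rule: poly_mapping_single_add_induct)
      (simp_all add: mult_single eval_single hom_mult eval_monomial_add eval_add algebra_simps)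
qed (simp_all add: eval_add algebra_simps)

lemma eval_one [simp]: "eval_mpoly \<iota> u 1 = 1"
  by (metis eval_const hom_one mp_const_def single_one)

lemma eval_minus: "eval_mpoly \<iota> u (f - g) = eval_mpoly \<iota> u f - eval_mpoly \<iota> u g"
  using eval_add[of u "f - g" g] by (simp add: algebra_simps)

lemma eval_sum: "eval_mpoly \<iota> u (sum f A) = (\<Sum>a\<in>A. eval_mpoly \<iota> u (f a))"
  by (induction A rule: infinite_finite_induct) (simp_all add: eval_add)

text \<open>Restriction of scalars along an evaluation. Both the Hibi ring and the specialized ring
  become modules over the polynomial ring in this way.\<close>

lemma module_eval: "module (\<lambda>s r. eval_mpoly \<iota> u s * r)"
  by standard (simp_all add: eval_add eval_mult algebra_simps)

end

lemma scalar_hom_mp_const: "scalar_hom (mp_const :: 'k::comm_ring_1 \<Rightarrow> ('v, 'k) mpoly)"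
  by standard (simp_all add: mp_const_def single_add mult_single)

lemma module_times: "module ((*) :: 'a::comm_ring_1 \<Rightarrow> _)"
  by standard (simp_all add: algebra_simps)

section \<open>Graded submodules of free modules\<close>

lemma keys_add_nat: "Poly_Mapping.keys (m + n :: 'v \<Rightarrow>\<^sub>0 nat) = Poly_Mapping.keys m \<union> Poly_Mapping.keys n"
  by (auto simp: in_keys_iff lookup_add)

lemma monomial_degree_superset:
  assumes "finite X" "Poly_Mapping.keys m \<subseteq> X"
  shows "monomial_degree m = (\<Sum>v\<in>X. Poly_Mapping.lookup m v)"
  unfolding monomial_degree_def
  using assms by (intro sum.mono_neutral_left) (auto simp: in_keys_iff)

lemma monomial_degree_add: "monomial_degree (m + n) = monomial_degree m + monomial_degree n"
  by (simp add: monomial_degree_superset[of "Poly_Mapping.keys m \<union> Poly_Mapping.keys n"]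
      keys_add_nat lookup_add sum.distrib)

lemma monomial_degree_single [simp]: "monomial_degree (Poly_Mapping.single v n) = n"
  by (cases "n = 0") (simp_all add: monomial_degree_def)

lemma monomial_degree_zero_iff [simp]: "monomial_degree m = 0 \<longleftrightarrow> m = 0"
proof
  assume "monomial_degree m = 0"
  then have "\<forall>a. Poly_Mapping.lookup m a = 0" by (auto simp: monomial_degree_def in_keys_iff)
  then show "m = 0" by (intro poly_mapping_eqI) simp
qed (simp add: monomial_degree_def)

lemma monomial_degree_zero [simp]: "monomial_degree 0 = 0"
  by (simp add: monomial_degree_def)

lemma monomial_split_var:
  fixes m :: "'v \<Rightarrow>\<^sub>0 nat"
  assumes "m \<noteq> 0"
  obtains v m' where "m = Poly_Mapping.single v 1 + m'"
proof -
  obtain v where v: "Poly_Mapping.lookup m v \<noteq> 0"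
    using assms poly_mapping_eqI by (metis lookup_zero)
  have "m = Poly_Mapping.single v 1 + (m - Poly_Mapping.single v 1)"
    using v by (intro poly_mapping_eqI) (auto simp: lookup_add lookup_minus lookup_single when_def)
  then show ?thesis using that by blast
qed

lemma monomial_degree_1E:
  assumes "monomial_degree m = 1"
  obtains v where "m = Poly_Mapping.single v 1"
proof -
  have "m \<noteq> 0" using assms by auto
  then obtain v m' where "m = Poly_Mapping.single v 1 + m'"
    using monomial_split_var by blast
  then show ?thesis using assms that by (auto simp: monomial_degree_add)
qed

lemma monomial_degree_2E:
  assumes "monomial_degree m = 2"
  obtains v w where "m = Poly_Mapping.single v 1 + Poly_Mapping.single w 1"
proof -
  have "m \<noteq> 0" using assms by auto
  then obtain v m' where m: "m = Poly_Mapping.single v 1 + m'"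
    using monomial_split_var by blast
  then have "monomial_degree m' = 1" using assms by (auto simp: monomial_degree_add)
  then show ?thesis using m that monomial_degree_1E by metis
qed

lemma finite_monomials_le_degree:
  assumes "finite (UNIV :: 'v set)"
  shows "finite {m :: 'v \<Rightarrow>\<^sub>0 nat. monomial_degree m \<le> j}"
proof -
  have le: "Poly_Mapping.lookup m v \<le> monomial_degree m" for m :: "'v \<Rightarrow>\<^sub>0 nat" and v
    using assms by (subst monomial_degree_superset[of UNIV]) (auto intro: member_le_sum)
  have "finite {f :: 'v \<Rightarrow> nat. \<forall>v. f v \<in> {..j}}"
    using finite_set_of_finite_funs[OF assms, of "{..j}" 0] by simp
  moreover have "Poly_Mapping.lookup ` {m. monomial_degree m \<le> j} \<subseteq> {f :: 'v \<Rightarrow> nat. \<forall>v. f v \<in> {..j}}"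
    using le le_trans by fastforce
  ultimately have "finite (Poly_Mapping.lookup ` {m :: 'v \<Rightarrow>\<^sub>0 nat. monomial_degree m \<le> j})"
    using finite_subset by blast
  then show ?thesis
    by (rule finite_imageD) (simp add: inj_on_def lookup_inject)
qed

definition mp_restrict :: "('m \<Rightarrow> bool) \<Rightarrow> ('m \<Rightarrow>\<^sub>0 'k::zero) \<Rightarrow> ('m \<Rightarrow>\<^sub>0 'k)" where
  "mp_restrict P f = Poly_Mapping.mapp (\<lambda>m c. if P m then c else 0) f"

lemma lookup_mp_restrict [simp]:
  "Poly_Mapping.lookup (mp_restrict P f) m = (if P m then Poly_Mapping.lookup f m else 0)"
  by (simp add: mp_restrict_def lookup_mapp when_def in_keys_iff)

lemma mp_restrict_zero [simp]: "mp_restrict P 0 = 0"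
  by (rule poly_mapping_eqI) simp

lemma mp_restrict_single [simp]:
  "mp_restrict P (Poly_Mapping.single m c) = (if P m then Poly_Mapping.single m c else 0)"
  by (rule poly_mapping_eqI) (auto simp: lookup_single when_def)

definition free_component :: "(nat \<Rightarrow> nat) \<Rightarrow> nat \<Rightarrow> (nat \<Rightarrow>\<^sub>0 ('v, 'k::comm_ring_1) mpoly) \<Rightarrow> _" where
  "free_component d j x = Poly_Mapping.mapp (\<lambda>k. mp_restrict (\<lambda>m. monomial_degree m + d k = j)) x"

lemma lookup_free_component [simp]:
  "Poly_Mapping.lookup (free_component d j x) k =
   mp_restrict (\<lambda>m. monomial_degree m + d k = j) (Poly_Mapping.lookup x k)"
  by (auto simp: free_component_def lookup_mapp when_def in_keys_iff)

lemma free_component_zero [simp]: "free_component d j 0 = 0"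
  by (rule poly_mapping_eqI) simp

lemma free_component_add: "free_component d j (x + y) = free_component d j x + free_component d j y"
  by (rule poly_mapping_eqI, rule poly_mapping_eqI) (simp add: lookup_add)

lemma free_component_sum: "free_component d j (sum f A) = (\<Sum>a\<in>A. free_component d j (f a))"
  by (induction A rule: infinite_finite_induct) (simp_all add: free_component_add)

definition free_homogeneous :: "(nat \<Rightarrow> nat) \<Rightarrow> nat \<Rightarrow> (nat \<Rightarrow>\<^sub>0 ('v, 'k::comm_ring_1) mpoly) \<Rightarrow> bool" where
  "free_homogeneous d j x \<longleftrightarrow>
     (\<forall>k. \<forall>m\<in>Poly_Mapping.keys (Poly_Mapping.lookup x k). monomial_degree m + d k = j)"

lemma free_homogeneous_component [simp]: "free_homogeneous d j (free_component d j x)"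
  by (auto simp: free_homogeneous_def in_keys_iff split: if_splits)

lemma free_component_homogeneous:
  assumes "free_homogeneous d i x"
  shows "free_component d j x = (if i = j then x else 0)"
  using assms
  by (intro poly_mapping_eqI[where 'b="('a, 'b) mpoly"] poly_mapping_eqI[where 'a="'a \<Rightarrow>\<^sub>0 nat"])
    (auto simp: free_homogeneous_def simp flip: not_in_keys_iff_lookup_eq_zero)

lemma keys_mult_single_subset:
  "Poly_Mapping.keys (Poly_Mapping.single m c * f :: ('v, 'k::comm_ring_1) mpoly) \<subseteq>
    (+) m ` Poly_Mapping.keys f"
  using keys_mult[of "Poly_Mapping.single m c" f] by (auto split: if_splits)

lemma free_homogeneous_scale_single:
  assumes "free_homogeneous d e y"
  shows "free_homogeneous d (monomial_degree m + e) (free_scale (Poly_Mapping.single m c) y)"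
  unfolding free_homogeneous_def
proof (intro allI ballI)
  fix k n assume "n \<in> Poly_Mapping.keys (Poly_Mapping.lookup (free_scale (Poly_Mapping.single m c) y) k)"
  then obtain n' where "n = m + n'" "n' \<in> Poly_Mapping.keys (Poly_Mapping.lookup y k)"
    using keys_mult_single_subset by fastforce
  then show "monomial_degree n + d k = monomial_degree m + e"
    using assms by (auto simp: free_homogeneous_def monomial_degree_add)
qed

lemma free_homogeneous_add:
  "free_homogeneous d j x \<Longrightarrow> free_homogeneous d j y \<Longrightarrow> free_homogeneous d j (x + y)"
  unfolding free_homogeneous_def lookup_add
  by (intro allI ballI) (drule subsetD[OF keys_add], auto)

lemma free_homogeneous_zero [simp]: "free_homogeneous d j 0"
  by (simp add: free_homogeneous_def)

lemma sum_free_components: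
  fixes x :: "nat \<Rightarrow>\<^sub>0 ('v, 'k::comm_ring_1) mpoly"
  obtains n where "x = (\<Sum>j<n. free_component d j x)"
proof -
  define D where "D = (\<Union>k\<in>Poly_Mapping.keys x.
    (\<lambda>m. monomial_degree m + d k) ` Poly_Mapping.keys (Poly_Mapping.lookup x k))"
  have "finite D" by (auto simp: D_def)
  then obtain n where n: "D \<subseteq> {..<n}" using finite_nat_iff_bounded by blast
  have "x = (\<Sum>j<n. free_component d j x)"
  proof (rule poly_mapping_eqI, rule poly_mapping_eqI)
    fix k and m :: "'v \<Rightarrow>\<^sub>0 nat"
    show "Poly_Mapping.lookup (Poly_Mapping.lookup x k) m =
      Poly_Mapping.lookup (Poly_Mapping.lookup (\<Sum>j<n. free_component d j x) k) m"
    proof (cases "Poly_Mapping.lookup (Poly_Mapping.lookup x k) m = 0")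
      case False
      then have "k \<in> Poly_Mapping.keys x" by (auto simp: in_keys_iff)
      then have "monomial_degree m + d k < n"
        using False n by (force simp: D_def in_keys_iff)
      then show ?thesis by (simp add: lookup_sum)
    next
      case True
      have "(\<Sum>j<n. if monomial_degree m + d k = j then 0 else (0::'k)) = 0"
        by (intro sum.neutral) simp
      with True show ?thesis by (simp add: lookup_sum)
    qed
  qed
  then show ?thesis using that by blast
qed

section \<open>Minimal homogeneous generators by linear algebra in each degree\<close>

lemma vector_space_free_scale:
  "vector_space (\<lambda>c. free_scale (mp_const c :: ('v, 'k::field) mpoly))"
proof -
  interpret M: module "free_scale :: ('v, 'k) mpoly \<Rightarrow> ('b \<Rightarrow>\<^sub>0 ('v, 'k) mpoly) \<Rightarrow> _"
    by (rule module_free_scale)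
  interpret C: scalar_hom "mp_const :: 'k \<Rightarrow> ('v, 'k) mpoly"
    by (rule scalar_hom_mp_const)
  show "vector_space (\<lambda>c. free_scale (mp_const c :: ('v, 'k) mpoly) :: ('b \<Rightarrow>\<^sub>0 ('v, 'k) mpoly) \<Rightarrow> _)"
    by standard (simp_all add: C.hom_add C.hom_mult M.scale_left_distrib M.scale_right_distrib)
qed

locale graded_submodule =
  fixes B :: "nat set" and d :: "nat \<Rightarrow> nat" and N :: "(nat \<Rightarrow>\<^sub>0 ('v, 'k::field) mpoly) set"
  assumes finite_vars: "finite (UNIV :: 'v set)"
    and finite_degree: "finite {k \<in> B. d k = j}"
    and subset_free: "N \<subseteq> free_module B"
    and zero_mem: "0 \<in> N"
    and add_mem: "x \<in> N \<Longrightarrow> y \<in> N \<Longrightarrow> x + y \<in> N"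
    and scale_mem: "x \<in> N \<Longrightarrow> free_scale s x \<in> N"
    and component_mem: "x \<in> N \<Longrightarrow> free_component d j x \<in> N"
begin

sublocale M: module "free_scale :: ('v, 'k) mpoly \<Rightarrow> (nat \<Rightarrow>\<^sub>0 ('v, 'k) mpoly) \<Rightarrow> _"
  by (rule module_free_scale)

sublocale V: vector_space "\<lambda>c. free_scale (mp_const c :: ('v, 'k) mpoly) :: (nat \<Rightarrow>\<^sub>0 ('v, 'k) mpoly) \<Rightarrow> _"
  by (rule vector_space_free_scale)

definition part :: "nat \<Rightarrow> (nat \<Rightarrow>\<^sub>0 ('v, 'k) mpoly) set" where
  "part j = {x \<in> N. free_homogeneous d j x}"

text \<open>The degree \<open>j\<close> part of the product of the irrelevant ideal with
  \<open>N\<close>. Variables have degree 1, whence \<open>Suc i = j\<close>; in degree 0 the span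
  is zero.\<close>

definition decomposable :: "nat \<Rightarrow> (nat \<Rightarrow>\<^sub>0 ('v, 'k) mpoly) set" where
  "decomposable j = V.span {free_scale (mp_var v) y | v y i. y \<in> part i \<and> Suc i = j}"

lemma sum_mem: "(\<And>a. a \<in> A \<Longrightarrow> f a \<in> N) \<Longrightarrow> sum f A \<in> N"
  by (induction A rule: infinite_finite_induct) (auto intro: zero_mem add_mem)

lemma part_scale_single:
  "y \<in> part e \<Longrightarrow> free_scale (Poly_Mapping.single m c) y \<in> part (monomial_degree m + e)"
  by (simp add: part_def scale_mem free_homogeneous_scale_single)

lemma subspace_part: "V.subspace (part j)"
  unfolding V.subspace_def
  using part_scale_single[of _ j 0]
  by (simp add: part_def zero_mem add_mem free_homogeneous_add mp_const_def)

lemma decomposable_subset_part: "decomposable j \<subseteq> part j"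
proof -
  have "{free_scale (mp_var v) y | v y i. y \<in> part i \<and> Suc i = j} \<subseteq> part j"
    using part_scale_single[of _ _ "Poly_Mapping.single _ 1"] by (auto simp: mp_var_def)
  then show ?thesis
    unfolding decomposable_def using subspace_part V.span_minimal by blast
qed

text \<open>Multiples of basis vectors by monomials span. For total degree \<open>j\<close>,
  monomial and basis vector both have degree at most \<open>j\<close>, which leaves finitely many
  choices.\<close>

lemma part_finite_span: "\<exists>E. finite E \<and> part j \<subseteq> V.span E"
proof -
  let ?I = "\<Union>i\<le>j. {k \<in> B. d k = i}"
  define E where "E = (\<lambda>(k, m). Poly_Mapping.single k (Poly_Mapping.single m (1::'k))) `
     (?I \<times> {m :: 'v \<Rightarrow>\<^sub>0 nat. monomial_degree m \<le> j})"
  have fin: "finite E"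
    unfolding E_def by (intro finite_imageI finite_SigmaI finite_monomials_le_degree finite_vars)
      (auto simp: finite_degree)
  have "x \<in> V.span E" if "x \<in> part j" for x
  proof -
    have "Poly_Mapping.single k (Poly_Mapping.lookup x k) \<in> V.span E" if k: "k \<in> Poly_Mapping.keys x" for k
    proof -
      let ?f = "Poly_Mapping.lookup x k"
      have "k \<in> B" using k \<open>x \<in> part j\<close> subset_free by (auto simp: part_def free_module_def)
      have "Poly_Mapping.single k (Poly_Mapping.single m (Poly_Mapping.lookup ?f m)) \<in> V.span E"
        if m: "m \<in> Poly_Mapping.keys ?f" for m
      proof -
        have "monomial_degree m + d k = j"
          using m \<open>x \<in> part j\<close> by (auto simp: part_def free_homogeneous_def)
        then have "Poly_Mapping.single k (Poly_Mapping.single m 1) \<in> E"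
          using \<open>k \<in> B\<close> unfolding E_def by (intro image_eqI[of _ _ "(k, m)"]) auto
        moreover have "Poly_Mapping.single k (Poly_Mapping.single m c) =
          free_scale (mp_const c) (Poly_Mapping.single k (Poly_Mapping.single m 1))" for c
          by (rule poly_mapping_eqI) (simp add: lookup_single when_def mp_const_def mult_single)
        ultimately show ?thesis by (metis V.span_base V.span_scale)
      qed
      then have "(\<Sum>m\<in>Poly_Mapping.keys ?f.
          Poly_Mapping.single k (Poly_Mapping.single m (Poly_Mapping.lookup ?f m))) \<in> V.span E"
        by (rule V.span_sum)
      also have "(\<Sum>m\<in>Poly_Mapping.keys ?f.
          Poly_Mapping.single k (Poly_Mapping.single m (Poly_Mapping.lookup ?f m))) =
          Poly_Mapping.single k (\<Sum>m\<in>Poly_Mapping.keys ?f. Poly_Mapping.single m (Poly_Mapping.lookup ?f m))"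
        by (rule poly_mapping_eqI) (auto simp: lookup_sum lookup_single when_def)
      also have "\<dots> = Poly_Mapping.single k ?f"
        using poly_mapping_sum_single[of ?f] by simp
      finally show ?thesis .
    qed
    then show ?thesis
      by (subst poly_mapping_sum_single) (rule V.span_sum)
  qed
  with fin show ?thesis by blast
qed

text \<open>A basis of the decomposable part is extended to a basis of the whole degree
  \<open>j\<close> part; the added vectors form \<open>C\<close>, a basis modulo the decomposable
  elements.\<close>

lemma complement_basis:
  "\<exists>C. finite C \<and> C \<subseteq> part j \<and> part j \<subseteq> V.span (C \<union> decomposable j) \<and>
       (\<forall>c. (\<Sum>y\<in>C. free_scale (mp_const (c y)) y) \<in> decomposable j \<longrightarrow> (\<forall>y\<in>C. c y = 0))"
proof -
  obtain A where A: "A \<subseteq> decomposable j" "V.independent A" "decomposable j \<subseteq> V.span A"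
    using V.maximal_independent_subset by blast
  have "A \<subseteq> part j" using A(1) decomposable_subset_part by blast
  then obtain D where D: "A \<subseteq> D" "D \<subseteq> part j" "V.independent D" "part j \<subseteq> V.span D"
    by (rule V.maximal_independent_subset_extend[OF _ A(2)])
  obtain E where E: "finite E" "part j \<subseteq> V.span E"
    using part_finite_span by blast
  have finD: "finite D"
    using V.independent_span_bound[OF E(1) D(3) order.trans[OF D(2) E(2)]] by simp
  then have finA: "finite A" using D(1) finite_subset by blast
  let ?C = "D - A"
  have gen: "part j \<subseteq> V.span (?C \<union> decomposable j)"
  proof -
    have "D \<subseteq> ?C \<union> decomposable j" using A(1) by auto
    then show ?thesis using D(4) V.span_mono by blast
  qed
  have indep: "\<forall>y\<in>?C. c y = 0" if "(\<Sum>y\<in>?C. free_scale (mp_const (c y)) y) \<in> decomposable j" for c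
  proof -
    have "(\<Sum>y\<in>?C. free_scale (mp_const (c y)) y) \<in> V.span A" using that A by blast
    then obtain a where a: "(\<Sum>y\<in>?C. free_scale (mp_const (c y)) y) = (\<Sum>y\<in>A. free_scale (mp_const (a y)) y)"
      using V.span_finite[OF finA] by auto
    let ?u = "\<lambda>y. if y \<in> A then - a y else c y"
    have "(\<Sum>y\<in>D. free_scale (mp_const (?u y)) y) =
        (\<Sum>y\<in>?C. free_scale (mp_const (?u y)) y) + (\<Sum>y\<in>A. free_scale (mp_const (?u y)) y)"
      by (rule sum.subset_diff[OF D(1) finD])
    also have "(\<Sum>y\<in>?C. free_scale (mp_const (?u y)) y) = (\<Sum>y\<in>?C. free_scale (mp_const (c y)) y)"
      by (intro sum.cong) auto
    also have "(\<Sum>y\<in>A. free_scale (mp_const (?u y)) y) = - (\<Sum>y\<in>A. free_scale (mp_const (a y)) y)"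
      by (simp add: sum_negf V.scale_minus_left)
    finally have "(\<Sum>y\<in>D. free_scale (mp_const (?u y)) y) = 0" using a by simp
    then have "\<forall>y\<in>D. ?u y = 0"
      using V.independentD[OF D(3) finD order.refl, where u="?u"] by blast
    then show ?thesis by auto
  qed
  show ?thesis
    using finD D(2) gen by (intro exI[of _ ?C] conjI allI impI indep) auto
qed

text \<open>Every nonconstant monomial of \<open>s\<close> contains a variable and so contributes
  only decomposable elements. The constant term keeps the degree of \<open>y\<close>, so it
  contributes only if \<open>e = j\<close>.\<close>

lemma component_scale_mod_decomposable:
  assumes y: "y \<in> part e"
  shows "free_component d j (free_scale s y) -
    (if e = j then free_scale (mp_const (Poly_Mapping.lookup s 0)) y else 0) \<in> decomposable j"
proof (induction s rule: poly_mapping_single_add_induct)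
  case zero
  show ?case by (simp add: decomposable_def V.span_zero)
next
  case (single m c)
  have comp: "free_component d j (free_scale (Poly_Mapping.single m c) y) =
    (if monomial_degree m + e = j then free_scale (Poly_Mapping.single m c) y else 0)"
    using part_scale_single[OF y] by (simp add: part_def free_component_homogeneous)
  have zero: "0 \<in> decomposable j"
    by (simp add: decomposable_def V.span_zero)
  show ?case
  proof (cases "m = 0")
    case True
    then show ?thesis using comp zero by (simp add: mp_const_def)
  next
    case False
    then obtain v m' where m: "m = Poly_Mapping.single v 1 + m'" using monomial_split_var by blast
    have "free_scale (Poly_Mapping.single m c) y \<in> decomposable j" if j: "monomial_degree m + e = j"
    proof -
      have "free_scale (Poly_Mapping.single m c) y =
          free_scale (mp_var v) (free_scale (Poly_Mapping.single m' c) y)"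
        by (simp add: m mp_var_def mult_single)
      then show ?thesis
        unfolding decomposable_def using part_scale_single[OF y, of m' c] j
        by (intro V.span_base CollectI exI[of _ v] exI[of _ "free_scale (Poly_Mapping.single m' c) y"]
            exI[of _ "monomial_degree m' + e"]) (simp add: m monomial_degree_add)
    qed
    then show ?thesis
      using comp False zero by (auto simp: lookup_single when_def mp_const_def)
  qed
next
  case (add s t)
  let ?D = "\<lambda>s. free_component d j (free_scale s y) -
    (if e = j then free_scale (mp_const (Poly_Mapping.lookup s 0)) y else 0)"
  have "?D (s + t) = ?D s + ?D t"
    by (simp add: M.scale_left_distrib free_component_add lookup_add mp_const_def single_add)
  then show ?case
    using V.span_add[OF add[unfolded decomposable_def]] by (simp only: decomposable_def)
qed

text \<open>Graded Nakayama: lifts of bases of the quotients by the decomposable parts generate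
  \<open>N\<close>, and their relations have no constant terms. The latter is the minimality
  condition for the next differential.\<close>

lemma minimal_generators:
  "\<exists>(B' :: nat set) d' g. (\<forall>j. finite {k \<in> B'. d' k = j}) \<and> (\<forall>k\<in>B'. g k \<in> N \<and> free_homogeneous d (d' k) (g k)) \<and>
     linear_extension free_scale g ` free_module B' = N \<and>
     (\<forall>x\<in>free_module B'. linear_extension free_scale g x = 0 \<longrightarrow>
        (\<forall>k. Poly_Mapping.lookup (Poly_Mapping.lookup x k) 0 = 0))"
proof -
  from choice[OF allI[OF complement_basis]] obtain C where C':
    "\<forall>j. finite (C j) \<and> C j \<subseteq> part j \<and> part j \<subseteq> V.span (C j \<union> decomposable j) \<and>
       (\<forall>c. (\<Sum>y\<in>C j. free_scale (mp_const (c y)) y) \<in> decomposable j \<longrightarrow> (\<forall>y\<in>C j. c y = 0))" ..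
  have C: "finite (C j)" "C j \<subseteq> part j" "part j \<subseteq> V.span (C j \<union> decomposable j)"
      "(\<Sum>y\<in>C j. free_scale (mp_const (c y)) y) \<in> decomposable j \<Longrightarrow> \<forall>y\<in>C j. c y = 0" for j c
    using C'[rule_format, of j] by simp_all
  have "\<forall>j. \<exists>h. bij_betw h {..<card (C j)} (C j)"
    using ex_bij_betw_nat_finite[OF C(1)] by (simp add: atLeast0LessThan)
  from choice[OF this] obtain b where b: "\<forall>j. bij_betw (b j) {..<card (C j)} (C j)" ..
  \<comment> \<open>Basis indices must be natural numbers, so a generator is coded by its degree
    \<open>j\<close> and its position \<open>i\<close> among those of degree
    \<open>j\<close>.\<close>
  define B' where "B' = {prod_encode (j, i) | j i. i < card (C j)}"
  define d' where "d' = (\<lambda>k. fst (prod_decode k))"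
  define g where "g = (\<lambda>k. b (fst (prod_decode k)) (snd (prod_decode k)))"
  have B'_degree: "{k \<in> B'. d' k = j} = (\<lambda>i. prod_encode (j, i)) ` {..<card (C j)}" for j
    by (auto simp: B'_def d'_def)
  then have fin: "finite {k \<in> B'. d' k = j}" for j by simp
  have bij_g: "bij_betw g {k \<in> B'. d' k = j} (C j)" for j
  proof -
    have "bij_betw (\<lambda>i. prod_encode (j, i)) {..<card (C j)} {k \<in> B'. d' k = j}"
      unfolding B'_degree by (auto simp: bij_betw_def inj_on_def)
    moreover have "bij_betw (g \<circ> (\<lambda>i. prod_encode (j, i))) {..<card (C j)} (C j)"
      using b by (simp add: g_def comp_def)
    ultimately show ?thesis by (rule bij_betw_comp_iff[THEN iffD2])
  qed
  have g_part: "g k \<in> part (d' k)" if "k \<in> B'" for k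
    using bij_g[of "d' k"] C(2) that by (auto simp: bij_betw_def)
  let ?L = "linear_extension free_scale g"
  have image_sub: "?L x \<in> N" if "x \<in> free_module B'" for x
    unfolding linear_extension_def using g_part that
    by (intro sum_mem scale_mem) (auto simp: part_def free_module_def)
  let ?im = "?L ` free_module B'"
  have im_add: "x + y \<in> ?im" if "x \<in> ?im" "y \<in> ?im" for x y
    using that by (auto simp: image_iff) (metis M.linear_extension_add free_module_add)
  have im_scale: "free_scale s x \<in> ?im" if "x \<in> ?im" for s x
    using that by (auto simp: image_iff) (metis M.linear_extension_scale free_module_scale)
  have im_zero: "0 \<in> ?im"
    using free_module_zero M.linear_extension_zero by (metis imageI)
  have im_subspace: "V.subspace ?im"
    unfolding V.subspace_def using im_add im_scale im_zero by blast
  \<comment> \<open>Induction on the degree: decomposable elements are multiples of elements of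
    lower degree, and \<open>C j\<close> supplies the rest.\<close>
  have part_im: "part j \<subseteq> ?im" for j
  proof (induction j rule: less_induct)
    case (less j)
    have "C j \<subseteq> ?im"
    proof
      fix y assume "y \<in> C j"
      then have "y \<in> g ` {k \<in> B'. d' k = j}" using bij_g[of j] by (simp add: bij_betw_def)
      then obtain k where k: "k \<in> B'" "g k = y" by blast
      then have "?L (Poly_Mapping.single k 1) = y" by simp
      then show "y \<in> ?im" using k free_module_single by (metis imageI)
    qed
    moreover have "free_scale (mp_var v) y \<in> ?im" if "y \<in> part i" "Suc i = j" for v y i
      using im_scale less[of i] that by blast
    then have "decomposable j \<subseteq> ?im"
      unfolding decomposable_def by (intro V.span_minimal im_subspace subsetI) fast
    ultimately show ?case using C(3)[of j] im_subspace V.span_minimal[of "C j \<union> decomposable j" ?im] by blast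
  qed
  have "N \<subseteq> ?im"
  proof
    fix x assume x: "x \<in> N"
    obtain n where n: "x = (\<Sum>j<n. free_component d j x)" using sum_free_components by blast
    have "free_component d j x \<in> ?im" for j
      by (rule subsetD[OF part_im[of j]]) (simp add: part_def component_mem x)
    then have "(\<Sum>j<n. free_component d j x) \<in> ?im"
      by (intro V.subspace_sum im_subspace)
    then show "x \<in> ?im" using n by simp
  qed
  then have image: "?im = N" using image_sub by auto
  have minimal: "Poly_Mapping.lookup (Poly_Mapping.lookup x k) 0 = 0"
    if x: "x \<in> free_module B'" and Lx: "?L x = 0" for x k
  proof (cases "k \<in> B'")
    case False
    then show ?thesis using x by (simp add: free_module_iff)
  next
    case True
    define j where "j = d' k"
    let ?c = "\<lambda>l. Poly_Mapping.lookup (Poly_Mapping.lookup x l) 0"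
    let ?inv = "inv_into {l \<in> B'. d' l = j} g"
    let ?t = "\<lambda>l. if d' l = j then free_scale (mp_const (?c l)) (g l) else 0"
    \<comment> \<open>The degree \<open>j\<close> component of the relation, modulo decomposable
      elements, involves only constant terms and generators of degree \<open>j\<close>. Below,
      \<open>?inv\<close> turns the coefficients into a function on \<open>C j\<close>, as the
      independence statement for \<open>C j\<close> requires.\<close>
    have "(\<Sum>l\<in>Poly_Mapping.keys x.
        free_component d j (free_scale (Poly_Mapping.lookup x l) (g l)) - ?t l) \<in> decomposable j"
      using x unfolding decomposable_def
      by (intro V.span_sum component_scale_mod_decomposable[unfolded decomposable_def] g_part)
        (auto simp: free_module_def)
    also have "(\<Sum>l\<in>Poly_Mapping.keys x.
        free_component d j (free_scale (Poly_Mapping.lookup x l) (g l)) - ?t l) =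
        free_component d j (?L x) - (\<Sum>l\<in>Poly_Mapping.keys x. ?t l)"
      by (simp add: sum_subtractf linear_extension_def free_component_sum)
    finally have "- (\<Sum>l\<in>Poly_Mapping.keys x. ?t l) \<in> decomposable j" using Lx by simp
    then have *: "(\<Sum>l\<in>Poly_Mapping.keys x. ?t l) \<in> decomposable j"
      unfolding decomposable_def using V.span_neg by fastforce
    have "(\<Sum>l\<in>Poly_Mapping.keys x. ?t l) =
        (\<Sum>l\<in>Poly_Mapping.keys x \<inter> {l \<in> B'. d' l = j}. free_scale (mp_const (?c l)) (g l))"
      using x by (intro sum.mono_neutral_cong_right) (auto simp: free_module_def)
    also have "\<dots> = (\<Sum>l\<in>{l \<in> B'. d' l = j}. free_scale (mp_const (?c l)) (g l))"
      using fin by (intro sum.mono_neutral_left) (auto simp: in_keys_iff mp_const_def)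
    also have "\<dots> = (\<Sum>l\<in>{l \<in> B'. d' l = j}. free_scale (mp_const (?c (?inv (g l)))) (g l))"
      using bij_g[of j] by (intro sum.cong) (auto simp: bij_betw_def)
    also have "\<dots> = (\<Sum>y\<in>C j. free_scale (mp_const (?c (?inv y))) y)"
      by (rule sum.reindex_bij_betw[OF bij_g])
    finally have "\<forall>y\<in>C j. ?c (?inv y) = 0"
      using * C(4)[where j = j and c = "\<lambda>y. ?c (?inv y)"] by simp
    moreover have "g k \<in> C j" using True bij_g[of j] by (auto simp: bij_betw_def j_def)
    moreover have "?inv (g k) = k"
      using True bij_g[of j] by (auto simp: bij_betw_def j_def)
    ultimately show ?thesis by auto
  qed
  show ?thesis
    by (intro exI[of _ B'] exI[of _ d'] exI[of _ g] conjI)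
      (use fin g_part image minimal in \<open>auto simp: part_def\<close>)
qed

end

section \<open>Existence of minimal graded free resolutions\<close>

lemma free_component_scale:
  assumes "free_homogeneous d e y"
  shows "free_component d j (free_scale s y) = free_scale (mp_restrict (\<lambda>m. monomial_degree m + e = j) s) y"
proof (induction s rule: poly_mapping_single_add_induct)
  case zero
  interpret module free_scale by (rule module_free_scale)
  show ?case by simp
next
  case (single m c)
  interpret module free_scale by (rule module_free_scale)
  show ?case
    using free_component_homogeneous[OF free_homogeneous_scale_single[OF assms]] by simp
next
  case (add s t)
  interpret module free_scale by (rule module_free_scale)
  have "mp_restrict P (s + t) = mp_restrict P s + mp_restrict P t" for P
    by (rule poly_mapping_eqI) (simp add: lookup_add)
  with add show ?case by (simp add: scale_left_distrib free_component_add)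
qed

lemma linear_extension_component:
  assumes "\<And>k. k \<in> Poly_Mapping.keys x \<Longrightarrow> free_homogeneous d (d' k) (g k)"
  shows "free_component d j (linear_extension free_scale g x) =
    linear_extension free_scale g (free_component d' j x)"
proof -
  interpret module free_scale by (rule module_free_scale)
  have "Poly_Mapping.keys (free_component d' j x) \<subseteq> Poly_Mapping.keys x"
    by (auto simp: in_keys_iff)
  then have "linear_extension free_scale g (free_component d' j x) =
      (\<Sum>k\<in>Poly_Mapping.keys x.
        free_scale (mp_restrict (\<lambda>m. monomial_degree m + d' k = j) (Poly_Mapping.lookup x k)) (g k))"
    by (simp add: linear_extension_superset[of "Poly_Mapping.keys x"])
  also have "\<dots> = (\<Sum>k\<in>Poly_Mapping.keys x. free_component d j (free_scale (Poly_Mapping.lookup x k) (g k)))"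
    by (intro sum.cong) (auto simp: free_component_scale[OF assms])
  finally show ?thesis by (simp add: linear_extension_def free_component_sum)
qed

text \<open>This closes the recursion: the kernel of one step is the graded submodule to be
  generated in the next.\<close>

lemma graded_submodule_kernel:
  assumes vars: "finite (UNIV :: 'v set)"
    and fin: "\<And>j. finite {k \<in> B'. d' k = j}"
    and hom: "\<And>k. k \<in> B' \<Longrightarrow> free_homogeneous d (d' k) (g k :: nat \<Rightarrow>\<^sub>0 ('v, 'k::field) mpoly)"
  shows "graded_submodule B' d' {x \<in> free_module B'. linear_extension free_scale g x = 0}"
proof -
  interpret module "free_scale :: ('v, 'k) mpoly \<Rightarrow> (nat \<Rightarrow>\<^sub>0 ('v, 'k) mpoly) \<Rightarrow> _" by (rule module_free_scale)
  have "linear_extension free_scale g (free_component d' j x) = 0"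
    if "x \<in> free_module B'" "linear_extension free_scale g x = 0" for x j
    using linear_extension_component[of x d d' g j] that hom by (auto simp: free_module_def)
  moreover have "free_component d' j x \<in> free_module B'" if "x \<in> free_module B'" for j x
    using that by (simp add: free_module_iff)
  ultimately show ?thesis
    by unfold_locales
      (auto simp: vars fin free_module_zero free_module_add free_module_scale
        linear_extension_add linear_extension_scale)
qed

text \<open>
  A resolution is built from successive minimal sets of homogeneous generators of the kernels, starting
  from a presentation \<open>F 0 \<rightarrow> M\<close> whose kernel \<open>N\<close> is contained in \<open>\<mm> * F 0\<close>.
\<close>

lemma ex_minimal_resolution_of_submodule:
  fixes N :: "(nat \<Rightarrow>\<^sub>0 ('v, 'k::field) mpoly) set"
  assumes N: "graded_submodule B0 d0 N"
    and minN: "\<And>x k. x \<in> N \<Longrightarrow> Poly_Mapping.lookup (Poly_Mapping.lookup x k) 0 = 0"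
  obtains B d diff where "B 0 = B0" "d 0 = d0" "\<And>i j. finite {k \<in> B i. d i k = j}"
    "\<And>i k. k \<in> B (Suc i) \<Longrightarrow> diff i k \<in> free_module (B i) \<and> free_homogeneous (d i) (d (Suc i) k) (diff i k)"
    "\<And>i k l. k \<in> B (Suc i) \<Longrightarrow> Poly_Mapping.lookup (Poly_Mapping.lookup (diff i k) l) 0 = 0"
    "linear_extension free_scale (diff 0) ` free_module (B 1) = N"
    "\<And>i. linear_extension free_scale (diff (Suc i)) ` free_module (B (Suc (Suc i))) =
       {x \<in> free_module (B (Suc i)). linear_extension free_scale (diff i) x = 0}"
proof -
  \<comment> \<open>A state consists of F i, its degrees, the submodule still to be covered, and the
    map into the previous module. Hence \<open>diff i\<close> is stored in state
    \<open>Suc i\<close>, and the initial state carries a dummy map.\<close>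
  define good where "good = (\<lambda>(B, d, N :: (nat \<Rightarrow>\<^sub>0 ('v, 'k) mpoly) set, g :: nat \<Rightarrow> nat \<Rightarrow>\<^sub>0 ('v, 'k) mpoly).
    graded_submodule B d N \<and> (\<forall>x\<in>N. \<forall>k. Poly_Mapping.lookup (Poly_Mapping.lookup x k) 0 = 0))"
  define step where "step = (\<lambda>(B :: nat set, d, N :: (nat \<Rightarrow>\<^sub>0 ('v, 'k) mpoly) set, g :: nat \<Rightarrow> nat \<Rightarrow>\<^sub>0 ('v, 'k) mpoly)
      (B' :: nat set, d' :: nat \<Rightarrow> nat, N', g').
    (\<forall>k\<in>B'. g' k \<in> N \<and> free_homogeneous d (d' k) (g' k)) \<and>
    linear_extension free_scale g' ` free_module B' = N \<and>
    N' = {x \<in> free_module B'. linear_extension free_scale g' x = 0})"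
  have "\<exists>f. \<forall>n. (good (f n) \<and> (n = 0 \<longrightarrow> f n = (B0, d0, N, \<lambda>_. 0))) \<and> step (f n) (f (Suc n))"
  proof (rule dependent_nat_choice)
    show "\<exists>x. good x \<and> (0 = (0::nat) \<longrightarrow> x = (B0, d0, N, \<lambda>_. 0))"
      using N minN by (auto simp: good_def)
  next
    fix s and n :: nat assume "good s \<and> (n = 0 \<longrightarrow> s = (B0, d0, N, \<lambda>_. 0))"
    moreover obtain B d M g where s: "s = (B, d, M, g)" by (cases s)
    ultimately interpret graded_submodule B d M by (simp add: good_def)
    from minimal_generators obtain B' :: "nat set" and d' g' where *: "\<forall>j. finite {k \<in> B'. d' k = j}"
      "\<forall>k\<in>B'. g' k \<in> M \<and> free_homogeneous d (d' k) (g' k)"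
      "linear_extension free_scale g' ` free_module B' = M"
      "\<forall>x\<in>free_module B'. linear_extension free_scale g' x = 0 \<longrightarrow>
        (\<forall>k. Poly_Mapping.lookup (Poly_Mapping.lookup x k) 0 = 0)"
      by (elim exE conjE)
    let ?t = "(B', d', {x \<in> free_module B'. linear_extension free_scale g' x = 0}, g')"
    have "good ?t" using graded_submodule_kernel[OF finite_vars, of B' d' d g'] * by (simp add: good_def)
    moreover have "step s ?t" using * by (simp add: step_def s)
    ultimately show "\<exists>y. (good y \<and> (Suc n = 0 \<longrightarrow> y = (B0, d0, N, \<lambda>_. 0))) \<and> step s y"
      by auto
  qed
  then obtain f where f: "\<And>n. good (f n)" "f 0 = (B0, d0, N, \<lambda>_. 0)" "\<And>n. step (f n) (f (Suc n))"
    by auto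
  define B where "B = (\<lambda>i. fst (f i))"
  define d where "d = (\<lambda>i. fst (snd (f i)))"
  define M where "M = (\<lambda>i. fst (snd (snd (f i))))"
  define diff where "diff = (\<lambda>i. snd (snd (snd (f (Suc i)))))"
  have fi: "f i = (B i, d i, M i, snd (snd (snd (f i))))" for i
    by (simp add: B_def d_def M_def)
  have good: "graded_submodule (B i) (d i) (M i)"
    "x \<in> M i \<Longrightarrow> Poly_Mapping.lookup (Poly_Mapping.lookup x k) 0 = 0" for i x k
    using f(1)[of i] by (subst (asm) fi, simp add: good_def)+
  have step: "\<And>k. k \<in> B (Suc i) \<Longrightarrow> diff i k \<in> M i \<and> free_homogeneous (d i) (d (Suc i) k) (diff i k)"
    "linear_extension free_scale (diff i) ` free_module (B (Suc i)) = M i"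
    "M (Suc i) = {x \<in> free_module (B (Suc i)). linear_extension free_scale (diff i) x = 0}" for i
    using f(3)[of i] by (subst (asm) fi, subst (asm) fi[of "Suc i"], simp add: step_def diff_def)+
  have 0: "B 0 = B0" "d 0 = d0" "M 0 = N" by (simp_all add: B_def d_def M_def f(2))
  show ?thesis
  proof (rule that[of B d diff])
    show "diff i k \<in> free_module (B i) \<and> free_homogeneous (d i) (d (Suc i) k) (diff i k)"
      if "k \<in> B (Suc i)" for i k
      using step(1)[OF that] graded_submodule.subset_free[OF good(1)[of i]] by blast
    show "finite {k \<in> B i. d i k = j}" for i j
      using graded_submodule.finite_degree[OF good(1)] .
    show "Poly_Mapping.lookup (Poly_Mapping.lookup (diff i k) l) 0 = 0" if "k \<in> B (Suc i)" for i k l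
      using step(1)[OF that] good(2) by blast
  qed (use 0 step in \<open>simp_all flip: step(3)\<close>)
qed

section \<open>Hibi rings\<close>

lemma finite_order_ideals: "finite (UNIV :: 'p::{finite,order} order_ideal set)"
proof -
  have "inj (elements :: 'p order_ideal \<Rightarrow> _)"
    by (simp add: inj_def elements_inject)
  then show ?thesis by (rule finite_imageD[rotated]) (rule finite_subset[OF subset_UNIV], simp)
qed

lemma prod_single: "(\<Prod>p\<in>A. Poly_Mapping.single (f p) (1::'k::comm_ring_1)) = Poly_Mapping.single (\<Sum>p\<in>A. f p) 1"
  by (induction A rule: infinite_finite_induct) (simp_all add: mult_single)

definition ideal_exponent :: "'p::{finite,order} order_ideal \<Rightarrow> 'p hibi_var \<Rightarrow>\<^sub>0 nat" where
  "ideal_exponent I = Poly_Mapping.single T 1 + (\<Sum>p\<in>elements I. Poly_Mapping.single (Z p) 1)"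

definition hibi_exponent :: "('p::{finite,order} order_ideal \<Rightarrow>\<^sub>0 nat) \<Rightarrow> 'p hibi_var \<Rightarrow>\<^sub>0 nat" where
  "hibi_exponent m = (\<Sum>I\<in>Poly_Mapping.keys m. \<Sum>i<Poly_Mapping.lookup m I. ideal_exponent I)"

lemma lookup_ideal_exponent [simp]:
  "Poly_Mapping.lookup (ideal_exponent I) T = 1"
  "Poly_Mapping.lookup (ideal_exponent I) (Z p) = of_bool (p \<in> elements I)"
  by (simp_all add: ideal_exponent_def lookup_add lookup_sum lookup_single when_def of_bool_def)

lemma hibi_gen_eq: "hibi_gen I = Poly_Mapping.single (ideal_exponent I) 1"
  by (simp add: hibi_gen_def mp_var_def prod_single mult_single ideal_exponent_def)

lemma eval_monomial_hibi_gen: "eval_monomial hibi_gen m = Poly_Mapping.single (hibi_exponent m) 1"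
proof -
  have "hibi_gen I ^ n = Poly_Mapping.single (\<Sum>i<n. ideal_exponent I) (1::'b)" for I :: "'a order_ideal" and n
    by (induction n) (simp_all add: hibi_gen_eq mult_single add.commute)
  then show ?thesis by (simp add: eval_monomial_def prod_single hibi_exponent_def)
qed

text \<open>Every generator contains \<open>T\<close> exactly once, so the exponent of
  \<open>T\<close> recovers the standard grading.\<close>

lemma hibi_exponent_T [simp]: "Poly_Mapping.lookup (hibi_exponent m) T = monomial_degree m"
  by (simp add: hibi_exponent_def lookup_sum monomial_degree_def)

lemma hibi_exponent_pair:
  "hibi_exponent (Poly_Mapping.single I 1 + Poly_Mapping.single J 1) = ideal_exponent I + ideal_exponent J"
proof -
  \<comment> \<open>Additivity of exponents is read off from multiplicativity of evaluation;
    \<open>real\<close> serves as some coefficient ring in which 1 is not 0.\<close>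
  have "eval_monomial hibi_gen (Poly_Mapping.single I 1 + Poly_Mapping.single J 1) =
      Poly_Mapping.single (ideal_exponent I + ideal_exponent J) (1::real)"
    by (simp add: eval_monomial_add hibi_gen_eq mult_single)
  then have "Poly_Mapping.keys (Poly_Mapping.single (hibi_exponent (Poly_Mapping.single I 1 + Poly_Mapping.single J 1)) (1::real)) =
    Poly_Mapping.keys (Poly_Mapping.single (ideal_exponent I + ideal_exponent J) (1::real))"
    by (simp add: eval_monomial_hibi_gen)
  then show ?thesis by simp
qed

lemma mp_subst_hibi_gen:
  "mp_subst hibi_gen f = (\<Sum>m\<in>Poly_Mapping.keys f. Poly_Mapping.single (hibi_exponent m) (Poly_Mapping.lookup f m))"
  unfolding mp_subst_eq_eval eval_mpoly_def
  by (simp add: eval_monomial_hibi_gen mp_const_def mult_single)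

lemma lookup_mp_subst_hibi_gen:
  assumes "finite X" "Poly_Mapping.keys f \<subseteq> X"
  shows "Poly_Mapping.lookup (mp_subst hibi_gen f) h =
    (\<Sum>m\<in>X. if hibi_exponent m = h then Poly_Mapping.lookup f m else 0)"
proof -
  have "Poly_Mapping.lookup (mp_subst hibi_gen f) h =
    (\<Sum>m\<in>Poly_Mapping.keys f. if hibi_exponent m = h then Poly_Mapping.lookup f m else 0)"
    by (auto simp: mp_subst_hibi_gen lookup_sum lookup_single when_def intro!: sum.cong)
  also have "\<dots> = (\<Sum>m\<in>X. if hibi_exponent m = h then Poly_Mapping.lookup f m else 0)"
    using assms by (intro sum.mono_neutral_left) (auto simp: in_keys_iff)
  finally show ?thesis .
qed

lemma mp_subst_hibi_gen_restrict:
  "mp_subst hibi_gen (mp_restrict (\<lambda>m. monomial_degree m = j) f) =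
   mp_restrict (\<lambda>h. Poly_Mapping.lookup h T = j) (mp_subst hibi_gen f)"
proof (rule poly_mapping_eqI)
  fix h
  have "Poly_Mapping.keys (mp_restrict (\<lambda>m. monomial_degree m = j) f) \<subseteq> Poly_Mapping.keys f"
    by (auto simp: in_keys_iff split: if_splits)
  then show "Poly_Mapping.lookup (mp_subst hibi_gen (mp_restrict (\<lambda>m. monomial_degree m = j) f)) h =
     Poly_Mapping.lookup (mp_restrict (\<lambda>h. Poly_Mapping.lookup h T = j) (mp_subst hibi_gen f)) h"
    by (auto simp: lookup_mp_subst_hibi_gen[of "Poly_Mapping.keys f"] intro!: sum.cong sum.neutral)
qed

text \<open>Only the monomial 1 has exponent vector 0, so no other term can cancel the constant one.
  This makes the presentation by a single generator minimal.\<close>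

lemma mp_subst_hibi_gen_zero_const:
  assumes "mp_subst hibi_gen f = 0"
  shows "Poly_Mapping.lookup f 0 = 0"
proof -
  have iff: "hibi_exponent m = 0 \<longleftrightarrow> m = 0" for m :: "'a order_ideal \<Rightarrow>\<^sub>0 nat"
    using hibi_exponent_T[of m] by (cases "hibi_exponent m = 0") (auto simp: hibi_exponent_def)
  have "0 = (\<Sum>m\<in>insert 0 (Poly_Mapping.keys f). if hibi_exponent m = 0 then Poly_Mapping.lookup f m else 0)"
    using lookup_mp_subst_hibi_gen[of "insert 0 (Poly_Mapping.keys f)" f 0] assms by auto
  also have "\<dots> = Poly_Mapping.lookup f 0" by (simp add: iff)
  finally show ?thesis by simp
qed

lemma hibi_ring_eq: "(hibi_ring :: ('p::{finite,order} hibi_var, 'k::field) mpoly set) = range (mp_subst hibi_gen)"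
proof -
  interpret scalar_hom "mp_const :: 'k \<Rightarrow> ('p hibi_var, 'k) mpoly" by (rule scalar_hom_mp_const)
  have "f \<in> range (mp_subst hibi_gen)" if "f \<in> hibi_ring" for f :: "('p hibi_var, 'k) mpoly"
    using that unfolding hibi_ring_def
  proof induction
    case (const c)
    show ?case by (rule range_eqI[of _ _ "mp_const c"]) (simp add: mp_subst_eq_eval)
  next
    case (gen g)
    then obtain I where "g = hibi_gen I" by auto
    then show ?case by (intro range_eqI[of _ _ "mp_var I"]) (simp add: mp_subst_eq_eval)
  next
    case (add f g)
    then obtain s t where "f = mp_subst hibi_gen s" "g = mp_subst hibi_gen t" by auto
    then show ?case by (intro range_eqI[of _ _ "s + t"]) (simp add: mp_subst_eq_eval eval_add)
  next
    case (mult f g)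
    then obtain s t where "f = mp_subst hibi_gen s" "g = mp_subst hibi_gen t" by auto
    then show ?case by (intro range_eqI[of _ _ "s * t"]) (simp add: mp_subst_eq_eval eval_mult)
  qed
  moreover have "mp_subst hibi_gen f \<in> hibi_ring" for f :: "('p order_ideal, 'k) mpoly"
  proof (induction f rule: poly_mapping_single_add_induct)
    case zero
    show ?case using subalgebra_generated.const[of 0 "range hibi_gen"]
      by (simp add: mp_subst_eq_eval hibi_ring_def mp_const_def)
  next
    case (single m c)
    show ?case
    proof (induction "monomial_degree m" arbitrary: m)
      case 0
      then show ?case using subalgebra_generated.const[of c "range hibi_gen"]
        by (simp add: mp_subst_eq_eval hibi_ring_def eval_single)
    next
      case (Suc n)
      then have "m \<noteq> 0" by auto
      then obtain I m' where m: "m = Poly_Mapping.single I 1 + m'" using monomial_split_var by blast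
      have "mp_subst hibi_gen (Poly_Mapping.single m c) =
          hibi_gen I * mp_subst hibi_gen (Poly_Mapping.single m' c)"
        by (simp add: mp_subst_eq_eval eval_single m eval_monomial_add algebra_simps)
      moreover have "n = monomial_degree m'" using Suc(2) by (simp add: m monomial_degree_add)
      ultimately show ?case
        using Suc(1)[of m'] subalgebra_generated.mult[OF subalgebra_generated.gen[of "hibi_gen I" "range hibi_gen"]]
        by (simp add: hibi_ring_def)
    qed
  next
    case (add f g)
    then show ?case unfolding hibi_ring_def mp_subst_eq_eval eval_add by (rule subalgebra_generated.add)
  qed
  ultimately show ?thesis by auto
qed

lemma module_hibi_scale:
  "module (hibi_scale :: ('p::{finite,order} order_ideal, 'k::field) mpoly \<Rightarrow> _)"
  using scalar_hom.module_eval[OF scalar_hom_mp_const]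
  unfolding hibi_scale_def[abs_def] mp_subst_eq_eval by blast

text \<open>F 0 is the polynomial ring itself, with basis vector 0 in degree 0 mapped to 1; the
  kernel of this presentation is graded and free of constant terms.\<close>

lemma ex_hibi_resolution:
  obtains B d aug diff where "minimal_graded_free_resolution
    (hibi_scale :: ('p::{finite,order} order_ideal, 'k::field) mpoly \<Rightarrow> _) hibi_ring hibi_component B d aug diff"
proof -
  interpret H: module "hibi_scale :: ('p order_ideal, 'k) mpoly \<Rightarrow> _" by (rule module_hibi_scale)
  let ?L = "linear_extension (hibi_scale :: ('p order_ideal, 'k) mpoly \<Rightarrow> _) (\<lambda>k::nat. 1)"
  let ?B = "{0::nat}" and ?d = "\<lambda>k::nat. 0::nat"
  let ?N = "{x \<in> free_module ?B. ?L x = 0}"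
  have L: "?L x = mp_subst hibi_gen (Poly_Mapping.lookup x 0)" if "x \<in> free_module ?B" for x
    using that by (subst H.linear_extension_superset[of ?B]) (auto simp: free_module_def hibi_scale_def)
  have "graded_submodule ?B ?d ?N"
  proof unfold_locales
    fix x j assume "x \<in> ?N"
    then have x: "x \<in> free_module ?B" "mp_subst hibi_gen (Poly_Mapping.lookup x 0) = 0" using L by auto
    have y: "free_component ?d j x \<in> free_module ?B" using x(1) by (simp add: free_module_iff)
    have "?L (free_component ?d j x) = 0"
      using mp_subst_hibi_gen_restrict[of j "Poly_Mapping.lookup x 0"] x(2) by (simp add: L[OF y])
    then show "free_component ?d j x \<in> ?N" using y by simp
  qed (auto simp: finite_order_ideals free_module_zero free_module_add free_module_scale
        H.linear_extension_add H.linear_extension_scale)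
  moreover have "Poly_Mapping.lookup (Poly_Mapping.lookup x k) 0 = 0" if "x \<in> ?N" for x k
  proof (cases "k = 0")
    case True
    then show ?thesis using that L[of x] mp_subst_hibi_gen_zero_const by auto
  qed (use that in \<open>simp add: free_module_iff\<close>)
  ultimately obtain B d diff where *: "B 0 = ?B" "d 0 = ?d" "\<And>i j. finite {k \<in> B i. d i k = j}"
    "\<And>i k. k \<in> B (Suc i) \<Longrightarrow> diff i k \<in> free_module (B i) \<and> free_homogeneous (d i) (d (Suc i) k) (diff i k)"
    "\<And>i k l. k \<in> B (Suc i) \<Longrightarrow> Poly_Mapping.lookup (Poly_Mapping.lookup (diff i k) l) 0 = 0"
    "linear_extension free_scale (diff 0) ` free_module (B 1) = ?N"
    "\<And>i. linear_extension free_scale (diff (Suc i)) ` free_module (B (Suc (Suc i))) =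
       {x \<in> free_module (B (Suc i)). linear_extension free_scale (diff i) x = 0}"
    using ex_minimal_resolution_of_submodule[of ?B ?d ?N] by (smt (verit) mem_Collect_eq)
  have "?L ` free_module ?B = hibi_ring"
  proof
    show "?L ` free_module ?B \<subseteq> hibi_ring" by (auto simp: L hibi_ring_eq)
    show "hibi_ring \<subseteq> ?L ` free_module ?B"
    proof
      fix f :: "('p hibi_var, 'k) mpoly" assume "f \<in> hibi_ring"
      then obtain s where "f = mp_subst hibi_gen s" by (auto simp: hibi_ring_eq)
      then have "f = ?L (Poly_Mapping.single 0 s)" by (simp add: hibi_scale_def)
      then show "f \<in> ?L ` free_module ?B" using free_module_single[of 0 ?B s] by blast
    qed
  qed
  moreover have "1 \<in> (hibi_component 0 :: ('p hibi_var, 'k) mpoly set)"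
    using subalgebra_generated.const[of 1 "range hibi_gen"]
    by (simp add: hibi_component_def hibi_ring_def mp_const_def)
  ultimately have "minimal_graded_free_resolution
    (hibi_scale :: ('p order_ideal, 'k) mpoly \<Rightarrow> _) hibi_ring hibi_component B d (\<lambda>_. 1) diff"
    unfolding minimal_graded_free_resolution_def using * by (auto simp: free_homogeneous_def)
  then show ?thesis using that by blast
qed

section \<open>Linear strands\<close>

lemma poly_eq_sum_monom:
  assumes "finite X" "\<And>k. k \<notin> X \<Longrightarrow> coeff p k = 0"
  shows "p = (\<Sum>k\<in>X. monom (coeff p k) k)"
proof (rule poly_eqI)
  fix n
  show "coeff p n = coeff (\<Sum>k\<in>X. monom (coeff p k) k) n"
    using assms by (cases "n \<in> X") (simp_all add: coeff_sum)
qed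

lemma coeff_mult_monom: "coeff (p * monom a n) k = (if k < n then 0 else coeff p (k - n) * (a::'k::comm_semiring_1))"
  by (simp only: mult.commute[of p] coeff_monom_mult mult.commute[of a])

lemma scalar_hom_const_poly: "scalar_hom (\<lambda>c. [:c:] :: 'k::comm_ring_1 poly)"
  by standard (simp_all add: one_pCons)

text \<open>The part F 3, F 2, F 1 of a resolution of the polynomial ring modulo \<open>J\<close> in
  which F i has all its basis elements in degree i + 1: the generators are quadrics, the entries of
  both differentials are linear forms. Exactness is recorded at \<open>J\<close>, F 1 and F
  2.\<close>

locale linear_strand =
  fixes J :: "('v, 'k::field) mpoly set" and B1 B2 B3 :: "nat set"
    and q :: "nat \<Rightarrow> ('v, 'k) mpoly" and \<sigma> \<tau> :: "nat \<Rightarrow> nat \<Rightarrow>\<^sub>0 ('v, 'k) mpoly"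
  assumes q_mem: "k \<in> B1 \<Longrightarrow> q k \<in> J"
    and q_degree: "k \<in> B1 \<Longrightarrow> m \<in> Poly_Mapping.keys (q k) \<Longrightarrow> monomial_degree m = 2"
    and generated: "f \<in> J \<Longrightarrow> \<exists>u\<in>free_module B1. linear_extension (*) q u = f"
    and \<sigma>_free: "k \<in> B2 \<Longrightarrow> \<sigma> k \<in> free_module B1"
    and \<sigma>_degree: "k \<in> B2 \<Longrightarrow> m \<in> Poly_Mapping.keys (Poly_Mapping.lookup (\<sigma> k) l) \<Longrightarrow> monomial_degree m = 1"
    and \<sigma>_syzygy: "k \<in> B2 \<Longrightarrow> linear_extension (*) q (\<sigma> k) = 0"
    and syzygy_generated: "u \<in> free_module B1 \<Longrightarrow> linear_extension (*) q u = 0 \<Longrightarrow>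
        \<exists>w\<in>free_module B2. linear_extension free_scale \<sigma> w = u"
    and \<tau>_free: "k \<in> B3 \<Longrightarrow> \<tau> k \<in> free_module B2"
    and \<tau>_degree: "k \<in> B3 \<Longrightarrow> m \<in> Poly_Mapping.keys (Poly_Mapping.lookup (\<tau> k) l) \<Longrightarrow> monomial_degree m = 1"
    and \<tau>_syzygy: "k \<in> B3 \<Longrightarrow> linear_extension free_scale \<sigma> (\<tau> k) = 0"
    and second_syzygy_generated: "w \<in> free_module B2 \<Longrightarrow> linear_extension free_scale \<sigma> w = 0 \<Longrightarrow>
        \<exists>t\<in>free_module B3. linear_extension free_scale \<tau> t = w"

text \<open>
  Kronecker substitution: five indeterminates \<open>y i\<close> are represented by the powers \<open>x ^ (1000 + 4 ^ i)\<close>,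
  with exponents \<open>1001, 1004, 1016, 1064, 1256\<close>, which separates all monomials of degree at most 3.
\<close>

locale kronecker_strand = linear_strand J B1 B2 B3 q \<sigma> \<tau>
  for J :: "('v, 'k::field) mpoly set" and B1 B2 B3 q \<sigma> \<tau> +
  fixes r :: "'v \<Rightarrow> 'k poly"
  assumes r_support: "k \<notin> {1001, 1004, 1016, 1064, 1256} \<Longrightarrow> coeff (r v) k = 0"
begin

sublocale scalar_hom "\<lambda>c. [:c:] :: 'k poly"
  by (rule scalar_hom_const_poly)

definition \<rho> :: "('v, 'k) mpoly \<Rightarrow> 'k poly" where
  "\<rho> = eval_mpoly (\<lambda>c. [:c:]) r"

text \<open>One coordinate of a comparison map: linear over \<open>\<rho>\<close>, with scalar value
  \<open>c k\<close> on the basis vector \<open>k\<close>.\<close>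

definition \<Phi> :: "(nat \<Rightarrow> 'k) \<Rightarrow> (nat \<Rightarrow>\<^sub>0 ('v, 'k) mpoly) \<Rightarrow> 'k poly" where
  "\<Phi> c = linear_extension (\<lambda>s p. \<rho> s * p) (\<lambda>k. [:c k:])"

sublocale R: module "\<lambda>s p. \<rho> s * p"
  unfolding \<rho>_def by (rule module_eval)

sublocale F: module "free_scale :: ('v, 'k) mpoly \<Rightarrow> (nat \<Rightarrow>\<^sub>0 ('v, 'k) mpoly) \<Rightarrow> _"
  by (rule module_free_scale)

sublocale S: module "(*) :: ('v, 'k) mpoly \<Rightarrow> _"
  by (rule module_times)

lemma \<rho>_simps: "\<rho> (f + g) = \<rho> f + \<rho> g" "\<rho> (f - g) = \<rho> f - \<rho> g" "\<rho> (f * g) = \<rho> f * \<rho> g"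
  by (simp_all add: \<rho>_def eval_add eval_minus eval_mult)

lemma \<Phi>_simps: "\<Phi> c (x + y) = \<Phi> c x + \<Phi> c y" "\<Phi> c (x - y) = \<Phi> c x - \<Phi> c y"
  "\<Phi> c (free_scale s x) = \<rho> s * \<Phi> c x"
  by (simp_all add: \<Phi>_def R.linear_extension_add R.linear_extension_minus R.linear_extension_scale)

lemma \<Phi>_eq_sum: "\<Phi> c x = (\<Sum>k\<in>Poly_Mapping.keys x. \<rho> (Poly_Mapping.lookup x k) * [:c k:])"
  by (simp add: \<Phi>_def linear_extension_def)

lemma \<rho>_monomial_degree_1: "monomial_degree m = 1 \<Longrightarrow> \<exists>v. eval_monomial r m = r v"
  by (elim monomial_degree_1E) auto

lemma \<rho>_linear:
  assumes "\<And>m. m \<in> Poly_Mapping.keys f \<Longrightarrow> monomial_degree m = 1"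
    and "k \<notin> {1001, 1004, 1016, 1064, 1256}"
  shows "coeff (\<rho> f) k = 0"
  unfolding \<rho>_def eval_mpoly_def coeff_sum
proof (intro sum.neutral ballI)
  fix m assume "m \<in> Poly_Mapping.keys f"
  then obtain v where "eval_monomial r m = r v" using assms(1) \<rho>_monomial_degree_1 by blast
  then show "coeff ([:Poly_Mapping.lookup f m:] * eval_monomial r m) k = 0"
    using r_support[OF assms(2)] by simp
qed

lemma \<Phi>_linear:
  assumes "\<And>l m. m \<in> Poly_Mapping.keys (Poly_Mapping.lookup x l) \<Longrightarrow> monomial_degree m = 1"
    and "k \<notin> {1001, 1004, 1016, 1064, 1256}"
  shows "coeff (\<Phi> c x) k = 0"
  unfolding \<Phi>_eq_sum coeff_sum
  using \<rho>_linear[OF assms(1) assms(2)] by (intro sum.neutral) (simp add: mult.commute[of _ "[:_:]"])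

text \<open>
  Nonconstant monomials in the \<open>y i\<close> have exponent at least 1000. This makes up for \<open>'k poly\<close> not
  carrying the grading by the number of factors \<open>y i\<close>.
\<close>

lemma gap_mult:
  assumes "\<And>k. 0 < k \<Longrightarrow> k < 1000 \<Longrightarrow> coeff p k = 0" "\<And>k. 0 < k \<Longrightarrow> k < 1000 \<Longrightarrow> coeff p' k = (0::'k)"
    and "0 < k" "k < 1000"
  shows "coeff (p * p') k = 0"
  unfolding coeff_mult
proof (intro sum.neutral ballI)
  fix i assume "i \<in> {..k}"
  then show "coeff p i * coeff p' (k - i) = 0"
    using assms(1)[of i] assms(2)[of "k - i"] assms(3,4) by (cases "i = 0") auto
qed

lemma gap_\<rho>:
  assumes "0 < k" "k < 1000"
  shows "coeff (\<rho> f) k = 0"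
proof (induction f rule: poly_mapping_single_add_induct)
  case (single m c)
  have "coeff (eval_monomial r m) k = 0"
  proof -
    have "coeff (eval_monomial r m) k = 0" if "0 < k" "k < 1000" for k
      using that
    proof (induction "monomial_degree m" arbitrary: m k)
      case 0
      then show ?case by simp
    next
      case (Suc n)
      then have "m \<noteq> 0" by auto
      then obtain v m' where m: "m = Poly_Mapping.single v 1 + m'" using monomial_split_var by blast
      then have "n = monomial_degree m'" using Suc(2) by (simp add: monomial_degree_add)
      then show ?case unfolding m eval_monomial_add
        using Suc r_support by (intro gap_mult) auto
    qed
    then show ?thesis using assms .
  qed
  then show ?case by (simp add: \<rho>_def eval_single)
qed (simp_all add: \<rho>_def eval_add)

lemma gap_\<Phi>: "0 < k \<Longrightarrow> k < 1000 \<Longrightarrow> coeff (\<Phi> c x) k = 0"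
  unfolding \<Phi>_eq_sum coeff_sum
  by (intro sum.neutral) (simp add: mult.commute[of _ "[:_:]"] gap_\<rho>)

text \<open>Each generator specializes to a scalar combination of the edge monomials with exponents
  in \<open>X\<close>. The scalars at \<open>e\<close> define the coordinate at \<open>e\<close> of
  the comparison map from F 1 to the free module on the edges.\<close>

lemma \<rho>_linear_extension:
  assumes "finite X" "\<And>f k. f \<in> J \<Longrightarrow> (\<And>m. m \<in> Poly_Mapping.keys f \<Longrightarrow> monomial_degree m = 2) \<Longrightarrow>
      k \<notin> X \<Longrightarrow> coeff (\<rho> f) k = 0"
    and u: "u \<in> free_module B1"
  shows "\<rho> (linear_extension (*) q u) = (\<Sum>e\<in>X. \<Phi> (\<lambda>k. coeff (\<rho> (q k)) e) u * monom 1 e)"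
proof -
  have q: "\<rho> (q k) = (\<Sum>e\<in>X. monom (coeff (\<rho> (q k)) e) e)" if "k \<in> Poly_Mapping.keys u" for k
    using that u q_mem q_degree assms(2)[of "q k"]
    by (intro poly_eq_sum_monom assms(1)) (auto simp: free_module_def)
  have monom: "monom c e = [:c:] * monom 1 e" for c :: 'k and e
    by (simp add: smult_monom)
  have "\<rho> (linear_extension (*) q u) = (\<Sum>k\<in>Poly_Mapping.keys u. \<rho> (Poly_Mapping.lookup u k) * \<rho> (q k))"
    by (simp add: \<rho>_def eval_sum eval_mult linear_extension_def)
  also have "\<dots> = (\<Sum>k\<in>Poly_Mapping.keys u. \<Sum>e\<in>X.
      \<rho> (Poly_Mapping.lookup u k) * [:coeff (\<rho> (q k)) e:] * monom 1 e)"
    by (intro sum.cong refl, subst q, assumption) (simp only: sum_distrib_left mult.assoc flip: monom)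
  also have "\<dots> = (\<Sum>e\<in>X. \<Phi> (\<lambda>k. coeff (\<rho> (q k)) e) u * monom 1 e)"
    by (subst sum.swap) (simp add: \<Phi>_eq_sum sum_distrib_right)
  finally show ?thesis .
qed

lemma \<Phi>_linear_extension:
  "\<Phi> c (linear_extension free_scale h w) = linear_extension (\<lambda>s p. \<rho> s * p) (\<lambda>k. \<Phi> c (h k)) w"
  by (simp add: \<Phi>_def R.linear_extension_comp)

text \<open>
  The Koszul syzygy between two quadrics specializing to \<open>y 0 * y 1\<close> and \<open>y 2 * y 3\<close> cannot be a
  combination of linear syzygies, because these two monomials have none.
\<close>

lemma no_two_disjoint_edges:
  assumes supp: "\<And>f k. f \<in> J \<Longrightarrow> (\<And>m. m \<in> Poly_Mapping.keys f \<Longrightarrow> monomial_degree m = 2) \<Longrightarrow>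
      k \<notin> {2005, 2080} \<Longrightarrow> coeff (\<rho> f) k = 0"
    and f: "f \<in> J" "\<rho> f = monom 1 2005" and g: "g \<in> J" "\<rho> g = monom 1 2080"
  shows False
proof -
  have \<rho>q: "\<rho> (linear_extension (*) q u) = (\<Sum>e\<in>{2005, 2080}. \<Phi> (\<lambda>k. coeff (\<rho> (q k)) e) u * monom 1 e)"
    if "u \<in> free_module B1" for u
    by (rule \<rho>_linear_extension[OF _ _ that]) (simp, (rule supp; simp))
  define A where "A = \<Phi> (\<lambda>k. coeff (\<rho> (q k)) 2005)"
  define A' where "A' = \<Phi> (\<lambda>k. coeff (\<rho> (q k)) 2080)"
  obtain u where u: "u \<in> free_module B1" "linear_extension (*) q u = f" using generated f by blast
  obtain v where v: "v \<in> free_module B1" "linear_extension (*) q v = g" using generated g by blast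
  have koszul: "free_scale g u - free_scale f v \<in> free_module B1"
    using u v by (simp add: free_module_iff lookup_minus)
  have "linear_extension (*) q (free_scale g u - free_scale f v) = 0"
    by (simp add: S.linear_extension_minus S.linear_extension_scale u v)
  then obtain w where w: "w \<in> free_module B2"
      "linear_extension free_scale \<sigma> w = free_scale g u - free_scale f v"
    using syzygy_generated koszul by blast
  \<comment> \<open>A linear relation between y0 y1 and y2 y3 is zero, as these monomials are
    coprime of degree 2.\<close>
  have A\<sigma>: "A (\<sigma> k) = 0" if k: "k \<in> B2" for k
  proof -
    have lin: "coeff (A (\<sigma> k)) n = 0" "coeff (A' (\<sigma> k)) n = 0" if "n \<notin> {1001, 1004, 1016, 1064, 1256}" for n
      unfolding A_def A'_def by (rule \<Phi>_linear[OF _ that], erule \<sigma>_degree[OF k])+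
    have "A (\<sigma> k) * monom 1 2005 + A' (\<sigma> k) * monom 1 2080 = 0"
      using \<rho>q[OF \<sigma>_free[OF k]] \<sigma>_syzygy[OF k] by (simp add: A_def A'_def \<rho>_def)
    then have c: "coeff (A (\<sigma> k) * monom 1 2005 + A' (\<sigma> k) * monom 1 2080) n = 0" for n
      by simp
    \<comment> \<open>At exponent 2005 + n, \<open>A'\<close> could only contribute its coefficient
      at n - 75, which is not the exponent of any y i.\<close>
    have "coeff (A (\<sigma> k)) n = 0" if "n \<in> {1001, 1004, 1016, 1064, 1256}" for n
      using that c[of "2005 + n"] by (auto simp: coeff_mult_monom lin)
    then show ?thesis using lin by (intro poly_eqI) (metis coeff_0)
  qed
  have "A (linear_extension free_scale \<sigma> w) = 0"
    unfolding A_def \<Phi>_linear_extension using w(1) A\<sigma>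
    by (simp add: linear_extension_def free_module_def A_def subset_iff)
  then have "monom 1 2080 * A u - monom 1 2005 * A v = 0"
    unfolding w(2) by (simp add: A_def \<Phi>_simps f g)
  then have "coeff (monom 1 2080 * A u - monom 1 2005 * A v) 2080 = 0" by simp
  \<comment> \<open>At exponent 2080, \<open>A v\<close> contributes its coefficient at 75, which
    lies in the gap.\<close>
  then have "coeff (A u) 0 = 0"
    by (simp add: coeff_monom_mult A_def gap_\<Phi>)
  moreover have "A u * monom 1 2005 + A' u * monom 1 2080 = monom 1 2005"
    using \<rho>q[OF u(1)] u(2) f(2) by (simp add: A_def A'_def)
  then have "coeff (A u * monom 1 2005 + A' u * monom 1 2080) 2005 = coeff (monom (1::'k) 2005) 2005"
    by simp
  then have "coeff (A u) 0 = 1" by (simp add: coeff_mult_monom)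
  ultimately show False by simp
qed

text \<open>
  The edge ideal of the pentagon, generated by the products \<open>y i * y (i + 1)\<close> (indices modulo 5), has the
  linear syzygies \<open>s i = y (i + 2) * e i - y i * e (i + 1)\<close>, and these have no linear syzygies. The
  second syzygy of degree 5 is lifted to \<open>J\<close> by means of the Pfaffian relations between \<open>Q 0, \<dots>, Q 4\<close>.
\<close>

lemma no_pentagon:
  assumes supp: "\<And>f k. f \<in> J \<Longrightarrow> (\<And>m. m \<in> Poly_Mapping.keys f \<Longrightarrow> monomial_degree m = 2) \<Longrightarrow>
      k \<notin> {2005, 2020, 2080, 2257, 2320} \<Longrightarrow> coeff (\<rho> f) k = 0"
    and Q0: "Q0 = xa * xb - xe * xab" and Q1: "Q1 = xa * xbd - xe * xabd"
    and Q2: "Q2 = xbd * xabc - xb * xf" and Q3: "Q3 = xabc * xabd - xab * xf"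
    and Q4: "Q4 = xab * xbd - xb * xabd"
    and Q: "Q0 \<in> J" "Q1 \<in> J" "Q2 \<in> J" "Q3 \<in> J" "Q4 \<in> J"
    and x: "\<rho> xb = monom 1 1001" "\<rho> xa = monom 1 1004" "\<rho> xbd = monom 1 1016" "\<rho> xabc = monom 1 1064"
      "\<rho> xabd = monom 1 1256" "\<rho> xe = 0" "\<rho> xab = 0" "\<rho> xf = 0"
  shows False
proof -
  have \<rho>q: "\<rho> (linear_extension (*) q u) = (\<Sum>e\<in>{2005, 2020, 2080, 2257, 2320}. \<Phi> (\<lambda>k. coeff (\<rho> (q k)) e) u * monom 1 e)"
    if "u \<in> free_module B1" for u
    by (rule \<rho>_linear_extension[OF _ _ that]) (simp, (rule supp; simp))
  define A where "A = (\<lambda>e. \<Phi> (\<lambda>k. coeff (\<rho> (q k)) e))"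
  have A_simps: "A e (x + y) = A e x + A e y" "A e (x - y) = A e x - A e y"
    "A e (free_scale s x) = \<rho> s * A e x" for e x y s
    by (simp_all add: A_def \<Phi>_simps)
  have A_sum: "\<rho> (linear_extension (*) q u) = A 2005 u * monom 1 2005 + A 2020 u * monom 1 2020 +
      A 2080 u * monom 1 2080 + A 2257 u * monom 1 2257 + A 2320 u * monom 1 2320"
    if "u \<in> free_module B1" for u
    using \<rho>q[OF that] by (simp add: A_def add.assoc)
  \<comment> \<open>With e i the basis vector of the edge y i * y (i + 1), \<open>P e k\<close> is
    the coordinate at the edge with exponent \<open>e\<close> of the specialized syzygy
    \<open>\<sigma> k\<close>.\<close>
  define P where "P = (\<lambda>e k. A e (\<sigma> k))"
  have linP: "coeff (P e k) n = 0" if k: "k \<in> B2" and n: "n \<notin> {1001, 1004, 1016, 1064, 1256}" for e k n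
    unfolding P_def A_def by (rule \<Phi>_linear[OF _ n], erule \<sigma>_degree[OF k])
  \<comment> \<open>The coordinates at e 0 and e 1 suffice to detect the coefficient of s 0: they
    involve only s 0, s 4 and s 0, s 1, respectively.\<close>
  have P: "P 2005 k = [:coeff (P 2005 k) 1016:] * monom 1 1016 + [:coeff (P 2005 k) 1256:] * monom 1 1256"
    "P 2020 k = [:coeff (P 2020 k) 1064:] * monom 1 1064 - [:coeff (P 2005 k) 1016:] * monom 1 1001"
    if k: "k \<in> B2" for k
  proof -
    have "P 2005 k * monom 1 2005 + P 2020 k * monom 1 2020 +
      P 2080 k * monom 1 2080 + P 2257 k * monom 1 2257 + P 2320 k * monom 1 2320 = 0"
      using A_sum[OF \<sigma>_free[OF k]] \<sigma>_syzygy[OF k] by (simp add: P_def \<rho>_def)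
    then have c: "coeff (P 2005 k * monom 1 2005 + P 2020 k * monom 1 2020 +
      P 2080 k * monom 1 2080 + P 2257 k * monom 1 2257 + P 2320 k * monom 1 2320) n = 0" for n
      by simp
    \<comment> \<open>The exponents 3006, 3009, 3069 belong to y0^2 y1, y0 y1^2, y0 y1 y3, where y0
      y1 is the only edge; 3024, 3036, 3276 belong to y1^2 y2, y1 y2^2, y1 y2 y4, where y1 y2 is the
      only edge; 3021 belongs to y0 y1 y2, which contains both.\<close>
    have c0: "coeff (P 2005 k) 1001 = 0" "coeff (P 2005 k) 1004 = 0" "coeff (P 2005 k) 1064 = 0"
      using c[of 3006] c[of 3009] c[of 3069] by (simp_all add: coeff_mult_monom linP[OF k])
    have c1: "coeff (P 2020 k) 1004 = 0" "coeff (P 2020 k) 1016 = 0" "coeff (P 2020 k) 1256 = 0"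
      using c[of 3024] c[of 3036] c[of 3276] by (simp_all add: coeff_mult_monom linP[OF k])
    have c2: "coeff (P 2020 k) 1001 = - coeff (P 2005 k) 1016"
      using c[of 3021] by (simp add: coeff_mult_monom linP[OF k] add_eq_0_iff)
    have expand: "P e k = (\<Sum>n\<in>{1001, 1004, 1016, 1064, 1256}. monom (coeff (P e k) n) n)" for e
      by (rule poly_eq_sum_monom) (simp, rule linP[OF k])
    show "P 2005 k = [:coeff (P 2005 k) 1016:] * monom 1 1016 + [:coeff (P 2005 k) 1256:] * monom 1 1256"
      by (rule trans[OF expand]) (simp add: c0 smult_monom)
    show "P 2020 k = [:coeff (P 2020 k) 1064:] * monom 1 1064 - [:coeff (P 2005 k) 1016:] * monom 1 1001"
      by (rule trans[OF expand]) (simp add: c1 c2 smult_monom minus_monom)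
  qed
  \<comment> \<open>Coordinates of the comparison map on F 2: the coefficients of s 0, of - s 4 and
    of s 1.\<close>
  define C where "C = \<Phi> (\<lambda>k. coeff (P 2005 k) 1016)"
  define D where "D = \<Phi> (\<lambda>k. coeff (P 2005 k) 1256)"
  define E where "E = \<Phi> (\<lambda>k. coeff (P 2020 k) 1064)"
  have A\<sigma>: "A 2005 (linear_extension free_scale \<sigma> w) = C w * monom 1 1016 + D w * monom 1 1256"
    "A 2020 (linear_extension free_scale \<sigma> w) = E w * monom 1 1064 - C w * monom 1 1001"
    if w: "w \<in> free_module B2" for w
  proof -
    have mem: "k \<in> B2" if "k \<in> Poly_Mapping.keys w" for k using w that by (auto simp: free_module_def)
    have *: "A e (linear_extension free_scale \<sigma> w) =
        (\<Sum>k\<in>Poly_Mapping.keys w. \<rho> (Poly_Mapping.lookup w k) * P e k)" for e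
      unfolding A_def \<Phi>_linear_extension by (simp add: linear_extension_def P_def A_def)
    show "A 2005 (linear_extension free_scale \<sigma> w) = C w * monom 1 1016 + D w * monom 1 1256"
      unfolding * C_def D_def \<Phi>_eq_sum sum_distrib_right sum.distrib[symmetric]
      by (intro sum.cong refl, subst P(1)[OF mem], assumption) (simp only: distrib_left mult.assoc)
    show "A 2020 (linear_extension free_scale \<sigma> w) = E w * monom 1 1064 - C w * monom 1 1001"
      unfolding * C_def E_def \<Phi>_eq_sum sum_distrib_right sum_subtractf[symmetric]
      by (intro sum.cong refl, subst P(2)[OF mem], assumption) (simp only: right_diff_distrib mult.assoc)
  qed
  \<comment> \<open>The relation with \<open>D\<close> makes the linear form
    \<open>C (\<tau> k)\<close> a multiple of y4, the one with \<open>E\<close> a multiple of y3; so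
    it vanishes.\<close>
  have C\<tau>: "C (\<tau> k) = 0" if k: "k \<in> B3" for k
  proof -
    have lin: "coeff (C (\<tau> k)) n = 0" "coeff (D (\<tau> k)) n = 0" "coeff (E (\<tau> k)) n = 0"
      if "n \<notin> {1001, 1004, 1016, 1064, 1256}" for n
      unfolding C_def D_def E_def by (rule \<Phi>_linear[OF _ that], erule \<tau>_degree[OF k])+
    have "C (\<tau> k) * monom 1 1016 + D (\<tau> k) * monom 1 1256 = 0"
      "E (\<tau> k) * monom 1 1064 - C (\<tau> k) * monom 1 1001 = 0"
      using A\<sigma>[OF \<tau>_free[OF k]] by (simp_all add: \<tau>_syzygy[OF k] A_def \<Phi>_def)
    then have c: "coeff (C (\<tau> k) * monom 1 1016 + D (\<tau> k) * monom 1 1256) n = 0"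
      "coeff (E (\<tau> k) * monom 1 1064 - C (\<tau> k) * monom 1 1001) n = 0" for n
      by simp_all
    have "coeff (C (\<tau> k)) n = 0" if "n \<in> {1001, 1004, 1016, 1064, 1256}" for n
      using that c(1)[of 2017] c(1)[of 2020] c(1)[of 2032] c(1)[of 2080] c(2)[of 2257]
      by (auto simp: coeff_mult_monom lin)
    then show ?thesis using lin by (intro poly_eqI) (metis coeff_0)
  qed
  obtain u0 u1 u2 u3 u4 where u: "u0 \<in> free_module B1" "linear_extension (*) q u0 = Q0"
    "u1 \<in> free_module B1" "linear_extension (*) q u1 = Q1"
    "u2 \<in> free_module B1" "linear_extension (*) q u2 = Q2"
    "u3 \<in> free_module B1" "linear_extension (*) q u3 = Q3"
    "u4 \<in> free_module B1" "linear_extension (*) q u4 = Q4"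
    using generated Q by metis
  \<comment> \<open>Four terms accommodate all five Pfaffian relations; those with three terms are
    padded by \<open>0 * Q0\<close>. The resulting w0, w1, w2, w3 lift s 0, s 1, s 2, s 3, while w4
    lifts - s 4.\<close>
  have syz: "\<exists>w\<in>free_module B2. linear_extension free_scale \<sigma> w =
      free_scale a u + free_scale b v + free_scale c u' + free_scale d v'"
    if "u \<in> free_module B1" "linear_extension (*) q u = f" "v \<in> free_module B1" "linear_extension (*) q v = g"
      "u' \<in> free_module B1" "linear_extension (*) q u' = f'" "v' \<in> free_module B1" "linear_extension (*) q v' = g'"
      "a * f + b * g + c * f' + d * g' = 0" for a b c d u v u' v' f g f' g'
    using that by (intro syzygy_generated free_module_add free_module_scale)
      (simp_all add: S.linear_extension_add S.linear_extension_scale)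
  have "xbd * Q0 + (- xb) * Q1 + xe * Q4 + 0 * Q0 = 0"
    by (simp add: Q0 Q1 Q4 algebra_simps del: S.scale_scale)
  from syz[OF u(1,2) u(3,4) u(9,10) u(1,2) this] obtain w0 where w0: "w0 \<in> free_module B2"
    "linear_extension free_scale \<sigma> w0 = free_scale xbd u0 + free_scale (- xb) u1 + free_scale xe u4 + free_scale 0 u0"
    by (rule bexE)
  have "xabc * Q1 + (- xa) * Q2 + (- xf) * Q0 + xe * Q3 = 0"
    by (simp add: Q0 Q1 Q2 Q3 algebra_simps del: S.scale_scale)
  from syz[OF u(3,4) u(5,6) u(1,2) u(7,8) this] obtain w1 where w1: "w1 \<in> free_module B2"
    "linear_extension free_scale \<sigma> w1 = free_scale xabc u1 + free_scale (- xa) u2 + free_scale (- xf) u0 + free_scale xe u3"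
    by (rule bexE)
  have "xabd * Q2 + (- xbd) * Q3 + (- xf) * Q4 + 0 * Q0 = 0"
    by (simp add: Q2 Q3 Q4 algebra_simps del: S.scale_scale)
  from syz[OF u(5,6) u(7,8) u(9,10) u(1,2) this] obtain w2 where w2: "w2 \<in> free_module B2"
    "linear_extension free_scale \<sigma> w2 = free_scale xabd u2 + free_scale (- xbd) u3 + free_scale (- xf) u4 + free_scale 0 u0"
    by (rule bexE)
  have "xb * Q3 + xabc * Q4 + (- xab) * Q2 + 0 * Q0 = 0"
    by (simp add: Q2 Q3 Q4 algebra_simps del: S.scale_scale)
  from syz[OF u(7,8) u(9,10) u(5,6) u(1,2) this] obtain w3 where w3: "w3 \<in> free_module B2"
    "linear_extension free_scale \<sigma> w3 = free_scale xb u3 + free_scale xabc u4 + free_scale (- xab) u2 + free_scale 0 u0"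
    by (rule bexE)
  have "xa * Q4 + xabd * Q0 + (- xab) * Q1 + 0 * Q0 = 0"
    by (simp add: Q0 Q1 Q4 algebra_simps del: S.scale_scale)
  from syz[OF u(9,10) u(1,2) u(3,4) u(1,2) this] obtain w4 where w4: "w4 \<in> free_module B2"
    "linear_extension free_scale \<sigma> w4 = free_scale xa u4 + free_scale xabd u0 + free_scale (- xab) u1 + free_scale 0 u0"
    by (rule bexE)
  \<comment> \<open>Listed in the order of their factors Q0, ..., Q4, the images of - w2, - w3, w4,
    - w0, w1 are the rows of a skew-symmetric matrix M applied to (u0, ..., u4). Since M kills the
    vector Q of Pfaffians, so does its transpose, and \<open>z\<close> is a syzygy. It specializes
    to minus the sum of the y (i + 3) * y (i + 4) * s i.\<close>
  define z where "z = free_scale Q4 w1 + free_scale Q2 w4 - free_scale Q3 w0 - free_scale Q0 w2 - free_scale Q1 w3"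
  have z: "z \<in> free_module B2"
    using w0(1) w1(1) w2(1) w3(1) w4(1) by (simp add: z_def free_module_iff lookup_minus lookup_add)
  have "linear_extension free_scale \<sigma> z = 0"
    unfolding z_def F.linear_extension_add F.linear_extension_minus F.linear_extension_scale
      w0(2) w1(2) w2(2) w3(2) w4(2)
    by (rule poly_mapping_eqI) (simp add: lookup_add lookup_minus Q0 Q1 Q2 Q3 Q4 algebra_simps del: S.scale_scale)
  then obtain t where t: "t \<in> free_module B3" "linear_extension free_scale \<tau> t = z"
    using second_syzygy_generated z by blast
  have "C (linear_extension free_scale \<tau> t) = 0"
    unfolding C_def \<Phi>_linear_extension using t(1) C\<tau>
    by (simp add: linear_extension_def free_module_def C_def subset_iff)
  then have "\<rho> Q4 * C w1 + \<rho> Q2 * C w4 - \<rho> Q3 * C w0 - \<rho> Q0 * C w2 - \<rho> Q1 * C w3 = 0"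
    by (simp add: t z_def C_def \<Phi>_simps)
  \<comment> \<open>In \<open>Q4\<close> the first product is the one that vanishes, hence the
    sign.\<close>
  moreover have \<rho>Q: "\<rho> Q0 = monom 1 2005" "\<rho> Q1 = monom 1 2020" "\<rho> Q2 = monom 1 2080" "\<rho> Q3 = monom 1 2320"
    "\<rho> Q4 = - monom 1 2257"
    by (simp_all add: Q0 Q1 Q2 Q3 Q4 \<rho>_simps x mult_monom)
  \<comment> \<open>The factor of s 0 is y3 y4, with exponent 2320. The other factors have smaller
    exponents and meet coefficients of the \<open>C w\<close> in the gap.\<close>
  ultimately have "coeff (monom 1 2080 * C w4 - monom 1 2257 * C w1 - monom 1 2320 * C w0 - monom 1 2005 * C w2 -
      monom 1 2020 * C w3) 2320 = 0"
    by simp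
  then have C0: "coeff (C w0) 0 = 0"
    by (simp add: coeff_monom_mult C_def gap_\<Phi>)
  \<comment> \<open>Comparing coefficients of y2 identifies the constant term of \<open>C w0\<close>
    with that of the e 0 coordinate of \<open>u0\<close>, which is 1 because \<open>Q0\<close>
    specializes to y0 y1.\<close>
  have "C w0 * monom 1 1016 + D w0 * monom 1 1256 = monom 1 1016 * A 2005 u0 - monom 1 1001 * A 2005 u1"
    using A\<sigma>(1)[OF w0(1)] \<rho>_simps(2)[of 0 xb] by (simp add: w0(2) A_simps x \<rho>_def[symmetric]) 
  then have "coeff (C w0 * monom 1 1016 + D w0 * monom 1 1256) 1016 =
      coeff (monom 1 1016 * A 2005 u0 - monom 1 1001 * A 2005 u1) 1016"
    by simp
  then have "coeff (A 2005 u0) 0 = 0"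
    by (simp add: coeff_mult_monom coeff_monom_mult C0 A_def gap_\<Phi>)
  moreover have "coeff (\<rho> (linear_extension (*) q u0)) 2005 = 1"
    by (simp add: u \<rho>Q)
  then have "coeff (A 2005 u0) 0 = 1"
    unfolding A_sum[OF u(1)] by (simp add: coeff_mult_monom)
  ultimately show False by simp
qed

end

section \<open>The strand of an arbitrary minimal resolution\<close>

lemma lookup_mult_zero:
  "Poly_Mapping.lookup (f * g :: ('v, 'k::comm_ring_1) mpoly) 0 = Poly_Mapping.lookup f 0 * Poly_Mapping.lookup g 0"
proof (induction f rule: poly_mapping_single_add_induct)
  case (single m c)
  have add_zero: "m + n = 0 \<longleftrightarrow> m = 0 \<and> n = 0" for n :: "'v \<Rightarrow>\<^sub>0 nat"
    by (simp only: monomial_degree_add add_eq_0_iff_both_eq_0 flip: monomial_degree_zero_iff)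
  show ?case
    by (induction g rule: poly_mapping_single_add_induct)
      (auto simp: mult_single lookup_single when_def lookup_add distrib_left add_zero)
qed (simp_all add: lookup_add distrib_right)

text \<open>The degree assumption starts at \<open>i = 1\<close>. Once F 0 is known to have a single
  basis vector, in degree 0 and mapped to a unit, the entries of the first differential are quadrics
  that generate the kernel.\<close>

lemma linear_strand_of_resolution:
  assumes res: "minimal_graded_free_resolution
      (hibi_scale :: ('p::{finite,order} order_ideal, 'k::field) mpoly \<Rightarrow> _) hibi_ring hibi_component B d aug diff"
    and deg: "\<And>i k. 1 \<le> i \<Longrightarrow> i \<le> 3 \<Longrightarrow> k \<in> B i \<Longrightarrow> d i k = i + 1"
  obtains q \<sigma> \<tau> where "linear_strand {f :: ('p order_ideal, 'k) mpoly. mp_subst hibi_gen f = 0} (B 1) (B 2) (B 3) q \<sigma> \<tau>"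
proof -
  interpret H: module "hibi_scale :: ('p order_ideal, 'k) mpoly \<Rightarrow> _" by (rule module_hibi_scale)
  interpret F: module "free_scale :: ('p order_ideal, 'k) mpoly \<Rightarrow> (nat \<Rightarrow>\<^sub>0 ('p order_ideal, 'k) mpoly) \<Rightarrow> _"
    by (rule module_free_scale)
  note R = res[unfolded minimal_graded_free_resolution_def]
  note aug = R[THEN conjunct2, THEN conjunct1, rule_format]
  note diff_all = R[THEN conjunct2, THEN conjunct2, THEN conjunct1, rule_format]
  have diff: "diff i k \<in> free_module (B i)" if "k \<in> B (Suc i)" for i k
    using diff_all[OF that] by simp
  have diff_degree: "monomial_degree m + d i l = d (Suc i) k"
    if "k \<in> B (Suc i)" "l \<in> B i" "m \<in> Poly_Mapping.keys (Poly_Mapping.lookup (diff i k) l)" for i k l m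
    using diff_all[OF that(1)] that(2,3) by simp
  note aug_image = R[THEN conjunct2, THEN conjunct2, THEN conjunct2, THEN conjunct1]
  note exact0 = R[THEN conjunct2, THEN conjunct2, THEN conjunct2, THEN conjunct2, THEN conjunct1]
  note exact = R[THEN conjunct2, THEN conjunct2, THEN conjunct2, THEN conjunct2, THEN conjunct2, THEN conjunct1, rule_format]
  note minimal = R[THEN conjunct2, THEN conjunct2, THEN conjunct2, THEN conjunct2, THEN conjunct2, THEN conjunct2, rule_format]
  have one: "1 \<in> (hibi_ring :: ('p hibi_var, 'k) mpoly set)"
    using subalgebra_generated.const[of 1 "range hibi_gen"] by (simp add: hibi_ring_def mp_const_def)
  then obtain e where e: "e \<in> free_module (B 0)" "linear_extension hibi_scale aug e = 1"
    using aug_image by (metis imageE)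
  \<comment> \<open>Modulo the irrelevant ideal, each basis vector is a scalar multiple of the lift
    \<open>e\<close> of 1: the difference lies in the kernel, whose elements have no constant terms
    by minimality. Hence the rank of F 0 is 1.\<close>
  have "\<exists>c. \<forall>l\<in>B 0. (if l = k then 1 else 0) = c * Poly_Mapping.lookup (Poly_Mapping.lookup e l) 0"
    if k: "k \<in> B 0" for k
  proof -
    have "aug k \<in> range (mp_subst hibi_gen)"
      using aug[OF k] by (simp add: hibi_component_def hibi_ring_eq)
    then obtain f where f: "aug k = mp_subst hibi_gen f" by blast
    define x where "x = Poly_Mapping.single k 1 - free_scale f e"
    have x: "x \<in> free_module (B 0)"
      using k e by (auto simp: x_def free_module_iff lookup_minus lookup_single when_def)
    have "linear_extension hibi_scale aug x = 0"
      by (simp add: x_def H.linear_extension_minus H.linear_extension_scale e)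
        (simp add: hibi_scale_def f mp_subst_eq_eval)
    with x obtain y where y: "y \<in> free_module (B 1)" "x = linear_extension free_scale (diff 0) y"
      using exact0 by (metis (mono_tags, lifting) imageE mem_Collect_eq)
    have const: "Poly_Mapping.lookup (Poly_Mapping.lookup x l) 0 = 0" if "l \<in> B 0" for l
      using y(1) minimal[of _ 0, OF _ that]
      by (auto simp: y(2) lookup_linear_extension linear_extension_def lookup_sum lookup_mult_zero
          free_module_def subset_iff intro!: sum.neutral)
    have "(if l = k then 1 else 0) = Poly_Mapping.lookup f 0 * Poly_Mapping.lookup (Poly_Mapping.lookup e l) 0"
      if "l \<in> B 0" for l
      using const[OF that] by (cases "l = k")
        (simp_all add: x_def lookup_minus lookup_mult_zero lookup_single_not_eq)
    then show ?thesis by blast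
  qed
  then obtain c where c: "\<And>k l. k \<in> B 0 \<Longrightarrow> l \<in> B 0 \<Longrightarrow>
      (if l = k then 1 else 0) = c k * Poly_Mapping.lookup (Poly_Mapping.lookup e l) 0"
    by metis
  have "e \<noteq> 0" using e(2) by auto
  then obtain k0 where "k0 \<in> Poly_Mapping.keys e" by fastforce
  then have "k0 \<in> B 0" using e(1) by (auto simp: free_module_def)
  moreover have "l = k0" if "l \<in> B 0" for l
    using c[of k0 l] c[of l l] c[of k0 k0] that \<open>k0 \<in> B 0\<close> by (auto split: if_splits)
  ultimately have B0: "B 0 = {k0}" by blast
  have single: "linear_extension hibi_scale aug x = mp_subst hibi_gen (Poly_Mapping.lookup x k0) * aug k0"
    if "x \<in> free_module (B 0)" for x
    using that by (subst H.linear_extension_superset[of "{k0}"]) (auto simp: free_module_def B0 hibi_scale_def)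
  have unit: "mp_subst hibi_gen (Poly_Mapping.lookup e k0) * aug k0 = 1"
    using single[OF e(1)] e(2) by simp
  \<comment> \<open>Some product of monomials of the two factors is 1. Exponents being natural
    numbers, that monomial of \<open>aug k0\<close> has \<open>T\<close>-exponent 0, which is the
    degree of \<open>k0\<close>.\<close>
  have "0 \<in> Poly_Mapping.keys (mp_subst hibi_gen (Poly_Mapping.lookup e k0) * aug k0)"
    by (simp add: unit)
  then obtain a b where ab: "0 = a + b" "b \<in> Poly_Mapping.keys (aug k0)"
    using keys_mult by blast
  have "Poly_Mapping.lookup b T = d 0 k0"
    using aug[of k0] ab(2) B0 by (simp add: hibi_component_def)
  moreover have "Poly_Mapping.lookup a T + Poly_Mapping.lookup b T = 0"
    by (metis ab(1) lookup_add lookup_zero)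
  ultimately have d0: "d 0 k0 = 0" by simp
  define q where "q = (\<lambda>k. Poly_Mapping.lookup (diff 0 k) k0)"
  have q_lin: "linear_extension free_scale (diff 0) u = 0 \<longleftrightarrow> linear_extension (*) q u = 0"
    if u: "u \<in> free_module (B 1)" for u
  proof -
    have "linear_extension free_scale (diff 0) u \<in> free_module {k0}"
      using u diff[of _ 0] B0 by (intro linear_extension_free_in) (auto simp: free_module_def)
    moreover have "Poly_Mapping.lookup (linear_extension free_scale (diff 0) u) k0 = linear_extension (*) q u"
      by (simp add: lookup_linear_extension q_def)
    ultimately show ?thesis
      by (metis (no_types, lifting) free_module_iff lookup_zero poly_mapping_eqI singletonD)
  qed
  have kernel: "linear_extension free_scale (diff i) (diff (Suc i) k) = 0" if k: "k \<in> B (Suc (Suc i))" for i k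
  proof -
    have "diff (Suc i) k \<in> linear_extension free_scale (diff (Suc i)) ` free_module (B (Suc (Suc i)))"
      using k by (intro image_eqI[of _ _ "Poly_Mapping.single k 1"] free_module_single) simp_all
    then show ?thesis using exact by blast
  qed
  have "linear_strand {f :: ('p order_ideal, 'k) mpoly. mp_subst hibi_gen f = 0} (B 1) (B 2) (B 3) q (diff 1) (diff 2)"
  proof
    fix k assume k: "k \<in> B 1"
    have "diff 0 k \<in> linear_extension free_scale (diff 0) ` free_module (B 1)"
      using k by (intro image_eqI[of _ _ "Poly_Mapping.single k 1"] free_module_single) simp_all
    then have "mp_subst hibi_gen (q k) * aug k0 = 0"
      using exact0 single by (auto simp: q_def)
    \<comment> \<open>The factor \<open>aug k0\<close> is cancelled by means of its inverse.\<close>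
    then have "mp_subst hibi_gen (q k) * (mp_subst hibi_gen (Poly_Mapping.lookup e k0) * aug k0) = 0"
      by (simp only: mult.left_commute[of "mp_subst hibi_gen (q k)"] mult_zero_right)
    then show "q k \<in> {f. mp_subst hibi_gen f = 0}" by (simp add: unit)
    fix m assume "m \<in> Poly_Mapping.keys (q k)"
    then show "monomial_degree m = 2"
      using diff_degree[of k 0 k0 m] deg[of 1 k] k by (simp add: q_def B0 d0)
  next
    fix f :: "('p order_ideal, 'k) mpoly" assume "f \<in> {f. mp_subst hibi_gen f = 0}"
    then have "linear_extension hibi_scale aug (Poly_Mapping.single k0 f) = 0"
      by (simp add: hibi_scale_def)
    moreover have "Poly_Mapping.single k0 f \<in> free_module (B 0)" by (simp add: B0 free_module_single)
    ultimately obtain u where "u \<in> free_module (B 1)" "linear_extension free_scale (diff 0) u = Poly_Mapping.single k0 f"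
      using exact0 by (metis (mono_tags, lifting) imageE mem_Collect_eq)
    moreover then have "linear_extension (*) q u = f"
      unfolding q_def lookup_linear_extension[symmetric] by simp
    ultimately show "\<exists>u\<in>free_module (B 1). linear_extension (*) q u = f" by blast
  next
    fix k assume k: "k \<in> B 2"
    show 1: "diff 1 k \<in> free_module (B 1)" using diff[of k 1] k by (simp add: numeral_2_eq_2)
    show "monomial_degree m = 1" if m: "m \<in> Poly_Mapping.keys (Poly_Mapping.lookup (diff 1 k) l)" for m l
    proof -
      have l: "l \<in> B 1" using 1 m by (cases "l \<in> B 1") (auto simp: free_module_iff)
      then show ?thesis using diff_degree[of k 1 l m] m k deg[of 1 l] deg[of 2 k] by (simp add: numeral_2_eq_2)
    qed
    show "linear_extension (*) q (diff 1 k) = 0"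
      using kernel[of k 0] k q_lin[OF 1] by (simp add: numeral_2_eq_2)
  next
    fix u assume "u \<in> free_module (B 1)" "linear_extension (*) q u = 0"
    then have "u \<in> linear_extension free_scale (diff 1) ` free_module (B 2)"
      using exact[of 0] q_lin[of u] by (simp add: numeral_2_eq_2)
    then show "\<exists>w\<in>free_module (B 2). linear_extension free_scale (diff 1) w = u" by blast
  next
    fix k assume k: "k \<in> B 3"
    show 1: "diff 2 k \<in> free_module (B 2)" using diff[of k 2] k by (simp add: numeral_3_eq_3)
    show "monomial_degree m = 1" if m: "m \<in> Poly_Mapping.keys (Poly_Mapping.lookup (diff 2 k) l)" for m l
    proof -
      have l: "l \<in> B 2" using 1 m by (cases "l \<in> B 2") (auto simp: free_module_iff)
      then show ?thesis using diff_degree[of k 2 l m] m k deg[of 2 l] deg[of 3 k] by (simp add: numeral_3_eq_3)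
    qed
    show "linear_extension free_scale (diff 1) (diff 2 k) = 0"
      using kernel[of k 1] k by (simp add: numeral_2_eq_2 numeral_3_eq_3)
  next
    fix w assume "w \<in> free_module (B 2)" "linear_extension free_scale (diff 1) w = 0"
    then have "w \<in> linear_extension free_scale (diff 2) ` free_module (B 3)"
      using exact[of 1] by (simp add: numeral_2_eq_2 numeral_3_eq_3)
    then show "\<exists>t\<in>free_module (B 3). linear_extension free_scale (diff 2) t = w" by blast
  qed
  then show ?thesis using that by blast
qed

text \<open>Existence turns the \<open>SOME\<close> in the Betti numbers into an actual resolution;
  their vanishing then confines its basis elements to degree i + 1.\<close>

lemma ex_linear_strand:
  assumes "hibi_property_N TYPE('p::{finite,order}) TYPE('k::field) 3"
  obtains B1 B2 B3 q \<sigma> \<tau> where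
    "linear_strand {f :: ('p order_ideal, 'k) mpoly. mp_subst hibi_gen f = 0} B1 B2 B3 q \<sigma> \<tau>"
proof -
  let ?res = "minimal_graded_free_resolution
      (hibi_scale :: ('p order_ideal, 'k) mpoly \<Rightarrow> _) hibi_ring hibi_component"
  let ?P = "\<lambda>(B, d). \<exists>aug diff. ?res B d aug diff"
  obtain B d where Bd: "(SOME s. ?P s) = (B, d)" by fastforce
  obtain B' d' aug' diff' where "?res B' d' aug' diff'" by (rule ex_hibi_resolution)
  then have "?P (B', d')" unfolding split_conv by (intro exI)
  then have "?P (SOME s. ?P s)" by (rule someI)
  then obtain aug diff where res: "?res B d aug diff" unfolding Bd split_conv by (elim exE)
  have betti: "hibi_betti TYPE('p) TYPE('k) i j = card {k \<in> B i. d i k = j}" for i j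
    using Bd by (simp add: hibi_betti_def graded_betti_def)
  have degree: "d i k = i + 1" if "1 \<le> i" "i \<le> 3" "k \<in> B i" for i k
  proof (rule ccontr)
    assume "d i k \<noteq> i + 1"
    then have "card {l \<in> B i. d i l = d i k} = 0"
      using assms that unfolding hibi_property_N_def betti[symmetric] by blast
    \<comment> \<open>Infinite sets also have \<open>card\<close> 0, so emptiness needs
      finiteness.\<close>
    moreover have "finite {l \<in> B i. d i l = d i k}"
      by (rule res[unfolded minimal_graded_free_resolution_def, THEN conjunct1, rule_format])
    ultimately show False using that(3) by auto
  qed
  show ?thesis
    by (rule linear_strand_of_resolution[OF res degree]) (assumption+, rule that)
qed

text \<open>
  Since \<open>\<Theta>\<close> depends on the multidegree only, it is killed by the relations of the Hibi ring, so that
  products of two variables may be corrected by it.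
\<close>

lemma hibi_quadric_support:
  fixes f :: "('p::{finite,order} order_ideal, 'k::field) mpoly"
  assumes f: "mp_subst hibi_gen f = 0" "\<And>m. m \<in> Poly_Mapping.keys f \<Longrightarrow> monomial_degree m = 2"
    and \<Theta>: "\<And>I J. coeff (r I * r J - \<Theta> (ideal_exponent I + ideal_exponent J)) k = 0"
  shows "coeff (eval_mpoly (\<lambda>c. [:c:]) r f) k = 0"
proof -
  have "(\<Sum>m\<in>Poly_Mapping.keys f. Poly_Mapping.lookup f m * coeff (\<Theta> (hibi_exponent m)) k) =
    (\<Sum>h\<in>hibi_exponent ` Poly_Mapping.keys f. \<Sum>m | m \<in> Poly_Mapping.keys f \<and> hibi_exponent m = h.
      Poly_Mapping.lookup f m * coeff (\<Theta> (hibi_exponent m)) k)"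
    by (rule sum.image_gen) simp
  also have "\<dots> = (\<Sum>h\<in>hibi_exponent ` Poly_Mapping.keys f. Poly_Mapping.lookup (mp_subst hibi_gen f) h * coeff (\<Theta> h) k)"
    by (intro sum.cong refl, subst lookup_mp_subst_hibi_gen[OF finite_keys order.refl])
      (simp add: sum_distrib_right sum.If_cases Int_def)
  also have "\<dots> = 0" by (simp add: f)
  finally have zero: "(\<Sum>m\<in>Poly_Mapping.keys f. Poly_Mapping.lookup f m * coeff (\<Theta> (hibi_exponent m)) k) = 0" .
  have "coeff (eval_mpoly (\<lambda>c. [:c:]) r f) k =
    (\<Sum>m\<in>Poly_Mapping.keys f. Poly_Mapping.lookup f m * coeff (eval_monomial r m) k)"
    by (simp add: eval_mpoly_def coeff_sum)
  also have "\<dots> = (\<Sum>m\<in>Poly_Mapping.keys f. Poly_Mapping.lookup f m * coeff (\<Theta> (hibi_exponent m)) k)"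
  proof (intro sum.cong refl)
    fix m assume "m \<in> Poly_Mapping.keys f"
    then obtain I J where m: "m = Poly_Mapping.single I 1 + Poly_Mapping.single J 1"
      using f(2) monomial_degree_2E by metis
    have "hibi_exponent m = ideal_exponent I + ideal_exponent J"
      unfolding m by (rule hibi_exponent_pair)
    moreover have "eval_monomial r m = r I * r J" by (simp add: m eval_monomial_add)
    ultimately show "Poly_Mapping.lookup f m * coeff (eval_monomial r m) k =
        Poly_Mapping.lookup f m * coeff (\<Theta> (hibi_exponent m)) k"
      using \<Theta>[of I J] by simp
  qed
  finally show ?thesis using zero by simp
qed

text \<open>The exponent vector of a product counts, for each poset element, the factors that
  contain it. In all applications \<open>I'\<close> and \<open>J'\<close> are the intersection and
  the union.\<close>

lemma hibi_relation:
  assumes "\<And>x. of_bool (x \<in> elements I) + of_bool (x \<in> elements J) =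
      of_bool (x \<in> elements I') + (of_bool (x \<in> elements J') :: nat)"
  shows "mp_subst hibi_gen (mp_var I * mp_var J - mp_var I' * mp_var J' ::
    ('p::{finite,order} order_ideal, 'k::field) mpoly) = 0"
proof -
  interpret scalar_hom "mp_const :: 'k \<Rightarrow> ('p hibi_var, 'k) mpoly" by (rule scalar_hom_mp_const)
  have "ideal_exponent I + ideal_exponent J = ideal_exponent I' + ideal_exponent J'"
  proof (rule poly_mapping_eqI)
    fix v show "Poly_Mapping.lookup (ideal_exponent I + ideal_exponent J) v =
        Poly_Mapping.lookup (ideal_exponent I' + ideal_exponent J') v"
      by (cases v) (simp_all add: lookup_add assms)
  qed
  then show ?thesis
    by (simp add: mp_subst_eq_eval eval_minus eval_mult hibi_gen_eq mult_single)
qed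

section \<open>Zigzags in connected posets\<close>

lemma ex_minimal_below: "\<exists>m\<in>minimal_elements. m \<le> (x :: 'p::{finite,order})"
  using finite_has_minimal2[of UNIV x] by (auto simp: minimal_elements_def less_le)

lemma ex_maximal_above: "\<exists>m\<in>maximal_elements. (x :: 'p::{finite,order}) \<le> m"
  using finite_has_maximal2[of UNIV x] by (auto simp: maximal_elements_def less_le)

lemma minimal_le_iff: "b \<in> minimal_elements \<Longrightarrow> a \<le> b \<longleftrightarrow> a = (b :: 'p::order)"
  by (auto simp: minimal_elements_def less_le)

lemma maximal_le_iff: "c \<in> maximal_elements \<Longrightarrow> c \<le> d \<longleftrightarrow> c = (d :: 'p::order)"
  by (auto simp: maximal_elements_def less_le)

text \<open>Otherwise the set and its complement would split the poset.\<close>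

lemma connected_poset_closed:
  assumes "connected_poset TYPE('p::order)" "A \<noteq> {}"
    and "\<And>x y :: 'p. x \<in> A \<Longrightarrow> x \<le> y \<or> y \<le> x \<Longrightarrow> y \<in> A"
  shows "A = UNIV"
proof (rule ccontr)
  assume "A \<noteq> UNIV"
  then have "A \<noteq> {} \<and> - A \<noteq> {} \<and> A \<inter> - A = {} \<and> A \<union> - A = UNIV \<and>
      (\<forall>a\<in>A. \<forall>b\<in>- A. \<not> a \<le> b \<and> \<not> b \<le> a)"
    using assms(2,3) by auto
  then show False
    by (rule notE[OF assms(1)[unfolded connected_poset_def] exI[of _ A, OF exI[of _ "- A"]]])
qed

text \<open>If one of the two links failed to exist, a principal filter or a principal ideal would
  be closed under comparability, hence everything. That would leave just one minimal or one maximal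
  element.\<close>

lemma ex_zigzag:
  assumes conn: "connected_poset TYPE('p::{finite,order})"
    and "card (minimal_elements :: 'p::{finite,order} set) \<ge> 2" "card (maximal_elements :: 'p::{finite,order} set) \<ge> 2"
  obtains a b c d :: "'p::{finite,order}" where "a \<in> minimal_elements" "b \<in> minimal_elements" "a \<noteq> b"
    "c \<in> maximal_elements" "d \<in> maximal_elements" "c \<noteq> d" "a \<le> c" "b \<le> c" "b \<le> d"
proof (rule ccontr)
  note zigzag = that
  assume contra: "\<not> thesis"
  have no: "c = d" if "a \<in> minimal_elements" "b \<in> minimal_elements" "a \<noteq> b"
    "c \<in> maximal_elements" "d \<in> maximal_elements" "a \<le> c" "b \<le> c" "b \<le> d" for a b c d :: 'p
    using contra zigzag that by blast
  obtain a0 b0 :: 'p where ab: "a0 \<in> minimal_elements" "b0 \<in> minimal_elements" "a0 \<noteq> b0"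
    using assms(2) by (auto simp: numeral_2_eq_2 card_le_Suc_iff)
  obtain c0 d0 :: 'p where cd: "c0 \<in> maximal_elements" "d0 \<in> maximal_elements" "c0 \<noteq> d0"
    using assms(3) by (auto simp: numeral_2_eq_2 card_le_Suc_iff)
  have "\<exists>a b c. a \<in> minimal_elements \<and> b \<in> minimal_elements \<and> a \<noteq> b \<and> c \<in> maximal_elements \<and> a \<le> c \<and> b \<le> (c::'p)"
  proof (rule ccontr)
    assume none: "\<not> ?thesis"
    \<comment> \<open>If no two minimal elements lie below a common maximal one, then going down
      from an element above \<open>b0\<close> leads to no other minimal element.\<close>
    have "{x. b0 \<le> x} = UNIV"
    proof (rule connected_poset_closed[OF conn])
      fix x y :: 'p assume x: "x \<in> {x. b0 \<le> x}" and xy: "x \<le> y \<or> y \<le> x"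
      obtain M where M: "M \<in> maximal_elements" "x \<le> M" using ex_maximal_above by blast
      obtain m where m: "m \<in> minimal_elements" "m \<le> y" using ex_minimal_below by blast
      show "y \<in> {x. b0 \<le> x}"
      proof (cases "x \<le> y")
        case False
        then have "m \<le> M" "b0 \<le> M" using xy m M x by (auto intro: order.trans)
        then have "m = b0" using none m(1) M(1) ab(2) by blast
        then show ?thesis using m by simp
      qed (use x in \<open>auto intro: order.trans\<close>)
    qed auto
    then have "b0 \<le> a0" by blast
    then show False using ab minimal_le_iff by metis
  qed
  then obtain a b c :: 'p where abc: "a \<in> minimal_elements" "b \<in> minimal_elements" "a \<noteq> b"
    "c \<in> maximal_elements" "a \<le> c" "b \<le> c" by blast
  \<comment> \<open>A minimal element below \<open>x\<close> differs from \<open>a\<close> or from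
    \<open>b\<close>, so together with that one it starts a zigzag unless every maximal element
    above it is \<open>c\<close>.\<close>
  have "{x. x \<le> c} = UNIV"
  proof (rule connected_poset_closed[OF conn])
    fix x y :: 'p assume x: "x \<in> {x. x \<le> c}" and xy: "x \<le> y \<or> y \<le> x"
    obtain M where M: "M \<in> maximal_elements" "y \<le> M" using ex_maximal_above by blast
    obtain m where m: "m \<in> minimal_elements" "m \<le> x" using ex_minimal_below by blast
    show "y \<in> {x. x \<le> c}"
    proof (cases "x \<le> y")
      case True
      then have "m \<le> M" "m \<le> c" using m M x by (auto intro: order.trans)
      then have "c = M" using no[of a m c M] no[of b m c M] abc m(1) M(1) by metis
      then show ?thesis using M by simp
    qed (use x xy in \<open>auto intro: order.trans\<close>)
  qed auto
  then have "c0 = c" "d0 = c" using cd maximal_le_iff by blast+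
  then show False using cd by simp
qed

section \<open>The two specializations\<close>

lemma ex_order_ideal:
  assumes "\<And>x y. P x \<Longrightarrow> y \<le> x \<Longrightarrow> P y"
  shows "\<exists>I. \<forall>x. x \<in> elements I \<longleftrightarrow> P x"
  using assms Order_Ideal_inverse[of "{x. P x}"] by (intro exI[of _ "Order_Ideal {x. P x}"]) auto

lemma elements_down: "x \<in> elements I \<Longrightarrow> y \<le> x \<Longrightarrow> y \<in> elements I"
  using elements[of I] by blast

text \<open>
  In the next two proofs, the variable of an order ideal \<open>I\<close> is specialized according to the trace of \<open>I\<close>
  on \<open>{a, b, c, d}\<close>, and \<open>\<Theta>0\<close> is nonzero on the traces of those multidegrees for which
  some product of two variables specializes to a product of the \<open>y i\<close> outside the edge ideal. The
  traces of the two factors are then determined by the multidegree.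
\<close>

lemma not_property_N_crown:
  fixes a b c d :: "'p::{finite,order}"
  assumes "a \<le> c" "b \<le> c" "a \<le> d" "b \<le> d" "\<not> a \<le> b" "\<not> b \<le> a" "\<not> c \<le> d" "\<not> d \<le> c"
  shows "\<not> hibi_property_N TYPE('p) TYPE('k::field) 3"
proof
  assume "hibi_property_N TYPE('p) TYPE('k) 3"
  then obtain B1 B2 B3 q \<sigma> \<tau> where
    "linear_strand {f :: ('p order_ideal, 'k) mpoly. mp_subst hibi_gen f = 0} B1 B2 B3 q \<sigma> \<tau>"
    by (rule ex_linear_strand)
  \<comment> \<open>The traces {a}, {b}, {a, b, c}, {a, b, d} give y0, y1, y2, y3. The others are
    intersections and unions of the incomparable pairs among these, and give 0.\<close>
  define r0 :: "bool \<Rightarrow> bool \<Rightarrow> bool \<Rightarrow> bool \<Rightarrow> 'k poly" where "r0 = (\<lambda>a b c d.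
    if a \<and> \<not> b then monom 1 1001 else if b \<and> \<not> a then monom 1 1004 else
    if c \<and> \<not> d then monom 1 1016 else if d \<and> \<not> c then monom 1 1064 else 0)"
  define r where "r = (\<lambda>I. r0 (a \<in> elements I) (b \<in> elements I) (c \<in> elements I) (d \<in> elements I))"
  \<comment> \<open>The four squares and the four products other than y0 y1 and y2 y3.\<close>
  define \<Theta>0 :: "nat \<times> nat \<times> nat \<times> nat \<Rightarrow> 'k poly" where "\<Theta>0 = (\<lambda>t.
    if t = (2, 0, 0, 0) then monom 1 2002 else if t = (0, 2, 0, 0) then monom 1 2008 else
    if t = (2, 2, 2, 0) then monom 1 2032 else if t = (2, 2, 0, 2) then monom 1 2128 else
    if t = (2, 1, 1, 0) then monom 1 2017 else if t = (2, 1, 0, 1) then monom 1 2065 else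
    if t = (1, 2, 1, 0) then monom 1 2020 else if t = (1, 2, 0, 1) then monom 1 2068 else 0)"
  define \<Theta> where "\<Theta> = (\<lambda>h. \<Theta>0 (Poly_Mapping.lookup h (Z a), Poly_Mapping.lookup h (Z b),
    Poly_Mapping.lookup h (Z c), Poly_Mapping.lookup h (Z d)))"
  interpret kronecker_strand "{f :: ('p order_ideal, 'k) mpoly. mp_subst hibi_gen f = 0}" B1 B2 B3 q \<sigma> \<tau> r
    by (intro kronecker_strand.intro kronecker_strand_axioms.intro, fact) (auto simp: r_def r0_def)
  have \<Theta>: "coeff (r I * r J - \<Theta> (ideal_exponent I + ideal_exponent J)) k = 0" if "k \<notin> {2005, 2080}" for I J k
  proof -
    \<comment> \<open>The order ideals of the subposet {a, b, c, d}, which are all the possible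
      traces.\<close>
    define L where "L = {(False, False, False, False), (True, False, False, False), (False, True, False, False),
      (True, True, False, False), (True, True, True, False), (True, True, False, True), (True, True, True, True)}"
    have pair: "coeff (r0 pa pb pc pd * r0 pa' pb' pc' pd' - \<Theta>0 (of_bool pa + of_bool pa', of_bool pb + of_bool pb',
        of_bool pc + of_bool pc', of_bool pd + of_bool pd')) k = 0"
      if "(pa, pb, pc, pd) \<in> L" "(pa', pb', pc', pd') \<in> L" for pa pb pc pd pa' pb' pc' pd'
      using that \<open>k \<notin> {2005, 2080}\<close> unfolding L_def
      by (elim insertE; simp add: r0_def \<Theta>0_def mult_monom)
    have mem: "(a \<in> elements I, b \<in> elements I, c \<in> elements I, d \<in> elements I) \<in> L" for I
      using elements_down[OF _ assms(1), of I] elements_down[OF _ assms(2), of I]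
        elements_down[OF _ assms(3), of I] elements_down[OF _ assms(4), of I]
      unfolding L_def by (cases "c \<in> elements I"; cases "d \<in> elements I") (simp_all, blast)
    show ?thesis unfolding r_def \<Theta>_def lookup_add lookup_ideal_exponent by (rule pair[OF mem mem])
  qed
  have supp: "coeff (\<rho> f) k = 0" if "f \<in> {f. mp_subst hibi_gen f = 0}"
    "\<And>m. m \<in> Poly_Mapping.keys f \<Longrightarrow> monomial_degree m = 2" "k \<notin> {2005, 2080}" for f k
    unfolding \<rho>_def using that \<Theta> by (intro hibi_quadric_support[where \<Theta> = \<Theta>]) auto
  have \<rho>_var: "\<rho> (mp_var I) = r0 (a \<in> elements I) (b \<in> elements I) (c \<in> elements I) (d \<in> elements I)" for I
    unfolding \<rho>_def eval_var by (simp add: r_def)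
  obtain Ia :: "'p order_ideal" where Ia: "\<And>x. x \<in> elements Ia \<longleftrightarrow> \<not> b \<le> x"
    using ex_order_ideal[of "\<lambda>x. \<not> b \<le> x"] by (blast intro: order.trans)
  obtain Ib :: "'p order_ideal" where Ib: "\<And>x. x \<in> elements Ib \<longleftrightarrow> \<not> a \<le> x"
    using ex_order_ideal[of "\<lambda>x. \<not> a \<le> x"] by (blast intro: order.trans)
  obtain Im :: "'p order_ideal" where Im: "\<And>x. x \<in> elements Im \<longleftrightarrow> \<not> a \<le> x \<and> \<not> b \<le> x"
    using ex_order_ideal[of "\<lambda>x. \<not> a \<le> x \<and> \<not> b \<le> x"] by (blast intro: order.trans)
  obtain Ij :: "'p order_ideal" where Ij: "\<And>x. x \<in> elements Ij \<longleftrightarrow> \<not> (a \<le> x \<and> b \<le> x)"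
    using ex_order_ideal[of "\<lambda>x. \<not> (a \<le> x \<and> b \<le> x)"] by (blast intro: order.trans)
  obtain Ic :: "'p order_ideal" where Ic: "\<And>x. x \<in> elements Ic \<longleftrightarrow> \<not> d \<le> x"
    using ex_order_ideal[of "\<lambda>x. \<not> d \<le> x"] by (blast intro: order.trans)
  obtain Id :: "'p order_ideal" where Id: "\<And>x. x \<in> elements Id \<longleftrightarrow> \<not> c \<le> x"
    using ex_order_ideal[of "\<lambda>x. \<not> c \<le> x"] by (blast intro: order.trans)
  obtain Km :: "'p order_ideal" where Km: "\<And>x. x \<in> elements Km \<longleftrightarrow> \<not> c \<le> x \<and> \<not> d \<le> x"
    using ex_order_ideal[of "\<lambda>x. \<not> c \<le> x \<and> \<not> d \<le> x"] by (blast intro: order.trans)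
  obtain Kj :: "'p order_ideal" where Kj: "\<And>x. x \<in> elements Kj \<longleftrightarrow> \<not> (c \<le> x \<and> d \<le> x)"
    using ex_order_ideal[of "\<lambda>x. \<not> (c \<le> x \<and> d \<le> x)"] by (blast intro: order.trans)
  have order: "\<not> c \<le> a" "\<not> c \<le> b" "\<not> d \<le> a" "\<not> d \<le> b" using assms order.trans by blast+
  let ?f = "mp_var Ia * mp_var Ib - mp_var Im * mp_var Ij :: ('p order_ideal, 'k) mpoly"
  let ?g = "mp_var Ic * mp_var Id - mp_var Km * mp_var Kj :: ('p order_ideal, 'k) mpoly"
  note mem = Ia Ib Im Ij Ic Id Km Kj
  show False
  proof (rule no_two_disjoint_edges[of ?f ?g])
    show "?f \<in> {f. mp_subst hibi_gen f = 0}" "?g \<in> {f. mp_subst hibi_gen f = 0}"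
      unfolding mem_Collect_eq by (rule hibi_relation; simp add: mem)+
    show "\<rho> ?f = monom 1 2005" "\<rho> ?g = monom 1 2080"
      by (simp_all add: \<rho>_simps \<rho>_var r0_def mem assms order mult_monom)
  qed (fact supp)
qed

lemma not_property_N_zigzag:
  fixes a b c d :: "'p::{finite,order}"
  assumes "a \<le> c" "b \<le> c" "b \<le> d" "\<not> a \<le> b" "\<not> b \<le> a" "\<not> c \<le> d" "\<not> d \<le> c" "\<not> a \<le> d"
  shows "\<not> hibi_property_N TYPE('p) TYPE('k::field) 3"
proof
  assume "hibi_property_N TYPE('p) TYPE('k) 3"
  then obtain B1 B2 B3 q \<sigma> \<tau> where
    "linear_strand {f :: ('p order_ideal, 'k) mpoly. mp_subst hibi_gen f = 0} B1 B2 B3 q \<sigma> \<tau>"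
    by (rule ex_linear_strand)
  \<comment> \<open>Around the pentagon, y0, ..., y4 are the traces {b}, {a}, {b, d}, {a, b, c}, {a,
    b, d}. Four edges are incomparable pairs. The fifth, y4 y0, is a comparable pair: in the
    relation between {a, b} and {b, d}, the factor {a, b} is sent to 0.\<close>
  define r0 :: "bool \<Rightarrow> bool \<Rightarrow> bool \<Rightarrow> bool \<Rightarrow> 'k poly" where "r0 = (\<lambda>a b c d.
    if a \<and> \<not> b then monom 1 1004 else if b \<and> \<not> a then if d then monom 1 1016 else monom 1 1001 else
    if c \<and> \<not> d then monom 1 1064 else if d \<and> \<not> c then monom 1 1256 else 0)"
  define r where "r = (\<lambda>I. r0 (a \<in> elements I) (b \<in> elements I) (c \<in> elements I) (d \<in> elements I))"
  \<comment> \<open>The five squares and the five diagonals of the pentagon.\<close>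
  define \<Theta>0 :: "nat \<times> nat \<times> nat \<times> nat \<Rightarrow> 'k poly" where "\<Theta>0 = (\<lambda>t.
    if t = (2, 0, 0, 0) then monom 1 2008 else if t = (0, 2, 0, 0) then monom 1 2002 else
    if t = (0, 2, 0, 2) then monom 1 2032 else if t = (2, 2, 2, 0) then monom 1 2128 else
    if t = (2, 2, 0, 2) then monom 1 2512 else if t = (0, 2, 0, 1) then monom 1 2017 else
    if t = (2, 1, 1, 0) then monom 1 2068 else if t = (2, 1, 0, 1) then monom 1 2260 else
    if t = (1, 2, 1, 0) then monom 1 2065 else if t = (1, 2, 0, 2) then monom 1 2272 else 0)"
  define \<Theta> where "\<Theta> = (\<lambda>h. \<Theta>0 (Poly_Mapping.lookup h (Z a), Poly_Mapping.lookup h (Z b),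
    Poly_Mapping.lookup h (Z c), Poly_Mapping.lookup h (Z d)))"
  interpret kronecker_strand "{f :: ('p order_ideal, 'k) mpoly. mp_subst hibi_gen f = 0}" B1 B2 B3 q \<sigma> \<tau> r
    by (intro kronecker_strand.intro kronecker_strand_axioms.intro, fact) (auto simp: r_def r0_def)
  have \<Theta>: "coeff (r I * r J - \<Theta> (ideal_exponent I + ideal_exponent J)) k = 0"
    if "k \<notin> {2005, 2020, 2080, 2257, 2320}" for I J k
  proof -
    define L where "L = {(False, False, False, False), (True, False, False, False), (False, True, False, False),
      (True, True, False, False), (False, True, False, True), (True, True, True, False), (True, True, False, True),
      (True, True, True, True)}"
    have pair: "coeff (r0 pa pb pc pd * r0 pa' pb' pc' pd' - \<Theta>0 (of_bool pa + of_bool pa', of_bool pb + of_bool pb',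
        of_bool pc + of_bool pc', of_bool pd + of_bool pd')) k = 0"
      if "(pa, pb, pc, pd) \<in> L" "(pa', pb', pc', pd') \<in> L" for pa pb pc pd pa' pb' pc' pd'
      using that \<open>k \<notin> {2005, 2020, 2080, 2257, 2320}\<close> unfolding L_def
      by (elim insertE; simp add: r0_def \<Theta>0_def mult_monom)
    have mem: "(a \<in> elements I, b \<in> elements I, c \<in> elements I, d \<in> elements I) \<in> L" for I
      using elements_down[OF _ assms(1), of I] elements_down[OF _ assms(2), of I]
        elements_down[OF _ assms(3), of I]
      unfolding L_def by (cases "c \<in> elements I"; cases "d \<in> elements I") (simp_all, blast+)
    show ?thesis unfolding r_def \<Theta>_def lookup_add lookup_ideal_exponent by (rule pair[OF mem mem])
  qed
  have supp: "coeff (\<rho> f) k = 0" if "f \<in> {f. mp_subst hibi_gen f = 0}"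
    "\<And>m. m \<in> Poly_Mapping.keys f \<Longrightarrow> monomial_degree m = 2" "k \<notin> {2005, 2020, 2080, 2257, 2320}" for f k
    unfolding \<rho>_def using that \<Theta> by (intro hibi_quadric_support[where \<Theta> = \<Theta>]) auto
  have \<rho>_var: "\<rho> (mp_var I) = r0 (a \<in> elements I) (b \<in> elements I) (c \<in> elements I) (d \<in> elements I)" for I
    unfolding \<rho>_def eval_var by (simp add: r_def)
  \<comment> \<open>The preimages of the ideals of \<open>{a, b, c, d}\<close> under the retraction sending \<open>x\<close> to the supremum of
    the elements below \<open>x\<close>; \<open>c\<close> is the supremum of \<open>a\<close> and \<open>b\<close>.\<close>
  obtain E :: "'p order_ideal" where E: "\<And>x. x \<in> elements E \<longleftrightarrow> \<not> a \<le> x \<and> \<not> b \<le> x"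
    using ex_order_ideal[of "\<lambda>x. \<not> a \<le> x \<and> \<not> b \<le> x"] by (blast intro: order.trans)
  obtain A :: "'p order_ideal" where A: "\<And>x. x \<in> elements A \<longleftrightarrow> \<not> b \<le> x"
    using ex_order_ideal[of "\<lambda>x. \<not> b \<le> x"] by (blast intro: order.trans)
  obtain B :: "'p order_ideal" where B: "\<And>x. x \<in> elements B \<longleftrightarrow> \<not> a \<le> x \<and> \<not> d \<le> x"
    using ex_order_ideal[of "\<lambda>x. \<not> a \<le> x \<and> \<not> d \<le> x"] by (blast intro: order.trans)
  obtain AB :: "'p order_ideal" where AB: "\<And>x. x \<in> elements AB \<longleftrightarrow> \<not> (a \<le> x \<and> b \<le> x) \<and> \<not> d \<le> x"
    using ex_order_ideal[of "\<lambda>x. \<not> (a \<le> x \<and> b \<le> x) \<and> \<not> d \<le> x"] by (blast intro: order.trans)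
  obtain BD :: "'p order_ideal" where BD: "\<And>x. x \<in> elements BD \<longleftrightarrow> \<not> a \<le> x"
    using ex_order_ideal[of "\<lambda>x. \<not> a \<le> x"] by (blast intro: order.trans)
  obtain ABC :: "'p order_ideal" where ABC: "\<And>x. x \<in> elements ABC \<longleftrightarrow> \<not> d \<le> x"
    using ex_order_ideal[of "\<lambda>x. \<not> d \<le> x"] by (blast intro: order.trans)
  obtain ABD :: "'p order_ideal" where ABD: "\<And>x. x \<in> elements ABD \<longleftrightarrow> \<not> (a \<le> x \<and> b \<le> x)"
    using ex_order_ideal[of "\<lambda>x. \<not> (a \<le> x \<and> b \<le> x)"] by (blast intro: order.trans)
  obtain F :: "'p order_ideal" where F: "\<And>x. x \<in> elements F \<longleftrightarrow> \<not> (a \<le> x \<and> d \<le> x)"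
    using ex_order_ideal[of "\<lambda>x. \<not> (a \<le> x \<and> d \<le> x)"] by (blast intro: order.trans)
  note mem = E A B AB BD ABC ABD F
  have order: "\<not> c \<le> a" "\<not> c \<le> b" "\<not> d \<le> a" "\<not> d \<le> b" using assms order.trans by blast+
  \<comment> \<open>Needed to identify unions: that of \<open>AB\<close> and \<open>BD\<close> is
    \<open>ABD\<close>, and that of \<open>ABC\<close> and \<open>ABD\<close> is
    \<open>F\<close>.\<close>
  have bd: "b \<le> x" if "d \<le> x" for x using assms(3) that by (rule order.trans)
  show False
  proof (rule no_pentagon[of _ "mp_var A" "mp_var B" "mp_var E" "mp_var AB" _ "mp_var BD" "mp_var ABD"
        _ "mp_var ABC" "mp_var F"])
    show "\<rho> (mp_var B) = monom 1 1001" "\<rho> (mp_var A) = monom 1 1004" "\<rho> (mp_var BD) = monom 1 1016"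
      "\<rho> (mp_var ABC) = monom 1 1064" "\<rho> (mp_var ABD) = monom 1 1256" "\<rho> (mp_var E) = 0"
      "\<rho> (mp_var AB) = 0" "\<rho> (mp_var F) = 0"
      by (simp_all add: \<rho>_var r0_def mem assms order)
    show "mp_var A * mp_var B - mp_var E * mp_var AB \<in> {f :: ('p order_ideal, 'k) mpoly. mp_subst hibi_gen f = 0}"
      "mp_var A * mp_var BD - mp_var E * mp_var ABD \<in> {f :: ('p order_ideal, 'k) mpoly. mp_subst hibi_gen f = 0}"
      "mp_var BD * mp_var ABC - mp_var B * mp_var F \<in> {f :: ('p order_ideal, 'k) mpoly. mp_subst hibi_gen f = 0}"
      "mp_var ABC * mp_var ABD - mp_var AB * mp_var F \<in> {f :: ('p order_ideal, 'k) mpoly. mp_subst hibi_gen f = 0}"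
      "mp_var AB * mp_var BD - mp_var B * mp_var ABD \<in> {f :: ('p order_ideal, 'k) mpoly. mp_subst hibi_gen f = 0}"
      unfolding mem_Collect_eq by (rule hibi_relation; use bd in \<open>auto simp: mem of_bool_def\<close>)+
  qed (fact supp | rule refl)+
qed

theorem theorem5p3:
  assumes "connected_poset TYPE('p::{finite,order})"
    and "card (minimal_elements :: 'p set) \<ge> 2"
    and "card (maximal_elements :: 'p set) \<ge> 2"
  shows "\<not> hibi_property_N TYPE('p) TYPE('k::field) 3"
proof -
  obtain a b c d :: 'p where *: "a \<in> minimal_elements" "b \<in> minimal_elements" "a \<noteq> b"
    "c \<in> maximal_elements" "d \<in> maximal_elements" "c \<noteq> d" "a \<le> c" "b \<le> c" "b \<le> d"
    using ex_zigzag[OF assms] by metis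
  then have incomparable: "\<not> a \<le> b" "\<not> b \<le> a" "\<not> c \<le> d" "\<not> d \<le> c"
    by (auto simp: minimal_le_iff maximal_le_iff)
  show ?thesis
  proof (cases "a \<le> d")
    case True
    with not_property_N_crown[of a c b d] * incomparable show ?thesis by simp
  next
    case False
    with not_property_N_zigzag[of a c b d] * incomparable show ?thesis by simp
  qed
qed

end
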